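(* Let $R$ be a weakly $\sigma$-distributive, super Dedekind complete algebra, $(T,d)$ a compact metric space with Borel $\sigma$-algebra $\Sigma$, and $\mu:\Sigma\to R$ a positive additive regular mapping. Let $F=\sum_{k=1}^nC_k1_{E_k}:T\to cf(R)$ be a simple multifunction with closed and bounded values, where $E_1,\dots,E_n\in\Sigma$ are pairwise disjoint and $C_1,\dots,C_n\in cf(R)$. Then for every $A\in\Sigma$ $$\Phi\Big(\sum_{k=1}^nC_k1_{E_k},A\Big)=\mathrm{cl}\left((A)\int_AF\,d\mu\right),$$ where $\Phi$ is the $( * )$-integral and $(A)\int$ is the Aumann integral.
   Context: A Riesz space $R$ is Dedekind complete if every nonempty subset bounded from above (below) has a supremum $\bigvee$ (infimum $\bigwedge$) in $R$; it is super Dedekind complete if moreover every nonempty subset bounded from above contains a countable subset having the same supremum. A $(D)$-sequence, or regulator, in $R$ is a bounded double sequence $(a_{i,j})_{i,j}$ with $a_{i,j}\ge a_{i,j+1}$ for all $i,j\in\mathbb{N}$ and $\bigwedge_j a_{i,j}=0$ for all $i$. A Dedekind complete $R$ is weakly $\sigma$-distributive if $\bigwedge_{\varphi\in\mathbb{N}^{\mathbb{N}}}\left(\bigvee_{i=1}^{\infty}a_{i,\varphi(i)}\right)=0$ for every $(D)$-sequence. A Dedekind complete Riesz space $R$ is an algebra if it carries a map $\cdot:R\times R\to R$ compatible with sums, order, suprema and infima: it is additive in each variable; if $r\ge s$ and $t\ge0$ then $r\cdot t\ge s\cdot t$ and $t\cdot r\ge t\cdot s$; and if a net $(a_\lambda)$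 decreases to $0$ and $b\ge0$ then $b\cdot a_\lambda$ and $a_\lambda\cdot b$ decrease to $0$. $\mu$ is regular if for every $E\in\Sigma$ there is a $(D)$-sequence $(a^E_{i,j})_{i,j}$ such that for every $\varphi:\mathbb{N}\to\mathbb{N}$ there are a compact $K$ and an open $U$ with $K\subset E\subset U$ and $\mu(U\setminus K)\le\bigvee_i a^E_{i,\varphi(i)}$. A gage on $T$ is a map $\gamma:T\to\mathbb{R}^+$ (strictly positive reals). A partition of $E\in\Sigma$ is a finite family $\{(E_i,t_i):i=1,\dots,k\}$ with $E_i\in\Sigma$, $t_i\in E_i$, $\mu(E_i\cap E_j)=0$ for $i\ne j$ and $\bigcup_i E_i=E$; it is $\gamma$-fine if $d(w,t_i)<\gamma(t_i)$ for all $i$ and all $w\in E_i$. For $C\subset R$ and $r\in R$, $r\ge 0$, put $\mathcal{U}(C,r)=\{z\in R:\exists x\in C,\ |x-z|\le r\}$, and $\mathrm{cl}(C)=\bigcup_{(a_{i,j})}\bigcap_{\varphi\in\mathbb{N}^{\mathbb{N}}}\mathcal{U}(C,\bigvee_i a_{i,\varphi(i)})$, the union being over all $(D)$-sequences; $C$ is closed if $C=\mathrm{cl}(C)$. $cf(R)$ is the family of all non-empty, convex, bounded and closed subsets of $R$. For sets $A_1,\dots,A_n\subset R$, $\sum_{i=1}^nA_i:=\mathrm{cl}(A_1+\dots+A_n)$ (closure of the algebraic sum); for $C\subset R$ and $r\in R$, $C\,r=\{c\cdot r:c\in C\}$. The multifunction $\sum_kC_k1_{E_k}$ equals $C_k$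 on $E_k$ and $\{0\}$ off $\bigcup_kE_k$. The $( * )$-integral $\Phi(F,E)$ of $F:T\to2^R$ on $E\in\Sigma$ is the set of all $z\in R$ for which there is a $(D)$-sequence $(a_{i,j})_{i,j}$ such that for all $\varphi\in\mathbb{N}^{\mathbb{N}}$ there is a gage $\gamma$ such that for every $\gamma$-fine partition $\{(E_i,t_i):i=1,\dots,k\}$ of $E$ there is $c\in\sum_{i=1}^kF(t_i)\mu(E_i)$ with $|z-c|\le\bigvee_{i=1}^\infty a_{i,\varphi(i)}$. A function $f:T\to R$ is $(KH)$-integrable on $E\in\Sigma$ (simply $(KH)$-integrable if $E=T$), with integral $\int_Ef\,d\mu=I\in R$, if there is a $(D)$-sequence $(a_{i,j})_{i,j}$ such that for all $\varphi\in\mathbb{N}^{\mathbb{N}}$ there is a gage $\gamma$ such that for every $\gamma$-fine partition $\{(E_i,t_i):i=1,\dots,q\}$ of $E$, $\left|\sum_{i=1}^qf(t_i)\mu(E_i)-I\right|\le\bigvee_{i=1}^\infty a_{i,\varphi(i)}$; such $I$ is unique, and $(KH)$-integrability on $T$ is inherited by every $E\in\Sigma$. For $F:T\to cf(R)$, $S^1_F$ is the set of $(KH)$-integrable $f:T\to R$ with $f(t)\in F(t)$ for $\mu$-almost every $t$. If $S^1_F\neq\emptyset$, the Aumann integral of $F$ on $E\in\Sigma$ is $(A)\int_EF\,d\mu=\{\int_Ef\,d\mu:f\in S^1_F\}$. *)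

theory Defs
  imports "HOL-Analysis.Analysis" "HOL-Library.Lattice_Algebras"
begin

section \<open>Dedekind complete Riesz spaces and algebras\<close>

class dedekind_complete_riesz_space =
  ordered_real_vector + conditionally_complete_lattice + lattice_ab_group_add_abs
begin

definition D_sequence :: "(nat \<Rightarrow> nat \<Rightarrow> 'a) \<Rightarrow> bool" where
  "D_sequence a \<longleftrightarrow>
     (\<exists>b. \<forall>i j. \<bar>a i j\<bar> \<le> b) \<and>
     (\<forall>i j. a i (Suc j) \<le> a i j) \<and>
     (\<forall>i. Inf (range (\<lambda>j. a i j)) = 0)"

end

text \<open>
  The subset \<open>B\<close> is required to be non-empty because \<^term>\<open>Sup {}\<close> is unspecified in a
  conditionally complete lattice.
\<close>

class super_dedekind_complete_riesz_space = dedekind_complete_riesz_space +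
  assumes countable_subset_same_Sup:
    "X \<noteq> {} \<Longrightarrow> bdd_above X \<Longrightarrow> \<exists>B\<subseteq>X. B \<noteq> {} \<and> countable B \<and> Sup B = Sup X"

class weakly_sigma_distributive_riesz_space = dedekind_complete_riesz_space +
  assumes weakly_sigma_distributive:
    "D_sequence a \<Longrightarrow> Inf (range (\<lambda>\<phi>::nat \<Rightarrow> nat. Sup (range (\<lambda>i. a i (\<phi> i))))) = 0"

text \<open>
  The product is neither assumed to be associative nor commutative.  Nets decreasing to \<open>0\<close> are
  represented by their ranges, i.e. by non-empty downward directed sets \<open>D\<close> with infimum \<open>0\<close>
  (conversely, such a set, indexed by itself, is a net decreasing to \<open>0\<close>).  That the products
  decrease is part of the monotonicity axioms.
\<close>

class dedekind_complete_algebra = dedekind_complete_riesz_space + times +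
  assumes prod_add_left: "(a + b) * c = a * c + b * c"
    and prod_add_right: "c * (a + b) = c * a + c * b"
    and prod_mono_left: "s \<le> r \<Longrightarrow> 0 \<le> t \<Longrightarrow> s * t \<le> r * t"
    and prod_mono_right: "s \<le> r \<Longrightarrow> 0 \<le> t \<Longrightarrow> t * s \<le> t * r"
    and prod_continuous_left:
      "D \<noteq> {} \<Longrightarrow> (\<And>x y. x \<in> D \<Longrightarrow> y \<in> D \<Longrightarrow> \<exists>z\<in>D. z \<le> x \<and> z \<le> y) \<Longrightarrow>
       bdd_below D \<Longrightarrow> Inf D = 0 \<Longrightarrow> 0 \<le> b \<Longrightarrow> Inf ((\<lambda>x. b * x) ` D) = 0"
    and prod_continuous_right:
      "D \<noteq> {} \<Longrightarrow> (\<And>x y. x \<in> D \<Longrightarrow> y \<in> D \<Longrightarrow> \<exists>z\<in>D. z \<le> x \<and> z \<le> y) \<Longrightarrow>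
       bdd_below D \<Longrightarrow> Inf D = 0 \<Longrightarrow> 0 \<le> b \<Longrightarrow> Inf ((\<lambda>x. x * b) ` D) = 0"


section \<open>Regularity, gages and partitions\<close>

definition regular_mapping ::
  "('t::metric_space set \<Rightarrow> 'r::dedekind_complete_riesz_space) \<Rightarrow> bool" where
  "regular_mapping \<mu> \<longleftrightarrow>
     (\<forall>E\<in>sets borel. \<exists>a. D_sequence a \<and>
        (\<forall>\<phi>. \<exists>K U. compact K \<and> open U \<and> K \<subseteq> E \<and> E \<subseteq> U \<and>
           \<mu> (U - K) \<le> (SUP i. a i (\<phi> i))))"

definition gage :: "('t \<Rightarrow> real) \<Rightarrow> bool" where
  "gage \<gamma> \<longleftrightarrow> (\<forall>t. 0 < \<gamma> t)"

text \<open>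
  A partition of \<open>A\<close> is the family of pairs \<open>(S i, \<tau> i)\<close> with \<open>i \<in> {1..q}\<close>.
\<close>

definition partition_of ::
  "('t::metric_space set \<Rightarrow> 'r::dedekind_complete_riesz_space) \<Rightarrow> 't set \<Rightarrow>
   nat \<Rightarrow> (nat \<Rightarrow> 't set) \<Rightarrow> (nat \<Rightarrow> 't) \<Rightarrow> bool" where
  "partition_of \<mu> A q S \<tau> \<longleftrightarrow>
     (\<forall>i\<in>{1..q}. S i \<in> sets borel \<and> \<tau> i \<in> S i) \<and>
     (\<forall>i\<in>{1..q}. \<forall>j\<in>{1..q}. i \<noteq> j \<longrightarrow> \<mu> (S i \<inter> S j) = 0) \<and>
     (\<Union>i\<in>{1..q}. S i) = A"

definition gamma_fine ::
  "('t::metric_space \<Rightarrow> real) \<Rightarrow> nat \<Rightarrow> (nat \<Rightarrow> 't set) \<Rightarrow> (nat \<Rightarrow> 't) \<Rightarrow> bool" where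
  "gamma_fine \<gamma> q S \<tau> \<longleftrightarrow> (\<forall>i\<in>{1..q}. \<forall>w\<in>S i. dist w (\<tau> i) < \<gamma> (\<tau> i))"


section \<open>Closure, and sums of sets\<close>

definition U_nbhd :: "'r::dedekind_complete_riesz_space set \<Rightarrow> 'r \<Rightarrow> 'r set" where
  "U_nbhd C r = {z. \<exists>x\<in>C. \<bar>x - z\<bar> \<le> r}"

definition cl :: "'r::dedekind_complete_riesz_space set \<Rightarrow> 'r set" where
  "cl C = (\<Union>a\<in>{a. D_sequence a}. \<Inter>\<phi>::nat \<Rightarrow> nat. U_nbhd C (SUP i. a i (\<phi> i)))"

text \<open>Boundedness is meant with respect to the order.\<close>

definition cf :: "'r::dedekind_complete_riesz_space set set" where
  "cf = {C. C \<noteq> {} \<and> convex C \<and> bdd_above C \<and> bdd_below C \<and> C = cl C}"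

text \<open>The sum below is the algebraic sum of sets from \<^theory>\<open>HOL-Library.Set_Algebras\<close>.\<close>

definition cl_sum :: "nat \<Rightarrow> (nat \<Rightarrow> 'r::dedekind_complete_riesz_space set) \<Rightarrow> 'r set" where
  "cl_sum q X = cl (\<Sum>i\<in>{1..q}. X i)"

definition set_times_elt :: "'r::dedekind_complete_algebra set \<Rightarrow> 'r \<Rightarrow> 'r set" where
  "set_times_elt C r = (\<lambda>c. c * r) ` C"

text \<open>For pairwise disjoint \<open>E k\<close>, the union has exactly one member \<open>C k\<close>.\<close>

definition simple_multifunction ::
  "nat \<Rightarrow> (nat \<Rightarrow> 'r::dedekind_complete_riesz_space set) \<Rightarrow> (nat \<Rightarrow> 't set) \<Rightarrow> 't \<Rightarrow> 'r set" where
  "simple_multifunction n C E t =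
     (if t \<in> (\<Union>k\<in>{1..n}. E k) then (\<Union>k\<in>{k\<in>{1..n}. t \<in> E k}. C k) else {0})"


section \<open>Integrals\<close>

definition star_integral ::
  "('t::metric_space set \<Rightarrow> 'r::dedekind_complete_algebra) \<Rightarrow> ('t \<Rightarrow> 'r set) \<Rightarrow> 't set \<Rightarrow> 'r set" where
  "star_integral \<mu> F A =
     {z. \<exists>a. D_sequence a \<and>
        (\<forall>\<phi>. \<exists>\<gamma>. gage \<gamma> \<and>
           (\<forall>q S \<tau>. partition_of \<mu> A q S \<tau> \<and> gamma_fine \<gamma> q S \<tau> \<longrightarrow>
              (\<exists>c\<in>cl_sum q (\<lambda>i. set_times_elt (F (\<tau> i)) (\<mu> (S i))).
                 \<bar>z - c\<bar> \<le> (SUP i. a i (\<phi> i)))))}"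

definition has_KH_integral ::
  "('t::metric_space set \<Rightarrow> 'r::dedekind_complete_algebra) \<Rightarrow> ('t \<Rightarrow> 'r) \<Rightarrow> 't set \<Rightarrow> 'r \<Rightarrow> bool" where
  "has_KH_integral \<mu> f A I \<longleftrightarrow>
     (\<exists>a. D_sequence a \<and>
        (\<forall>\<phi>. \<exists>\<gamma>. gage \<gamma> \<and>
           (\<forall>q S \<tau>. partition_of \<mu> A q S \<tau> \<and> gamma_fine \<gamma> q S \<tau> \<longrightarrow>
              \<bar>(\<Sum>i\<in>{1..q}. f (\<tau> i) * \<mu> (S i)) - I\<bar> \<le> (SUP i. a i (\<phi> i)))))"

definition ae ::
  "('t::metric_space set \<Rightarrow> 'r::dedekind_complete_riesz_space) \<Rightarrow> ('t \<Rightarrow> bool) \<Rightarrow> bool" where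
  "ae \<mu> P \<longleftrightarrow> (\<exists>N\<in>sets borel. \<mu> N = 0 \<and> (\<forall>t. t \<notin> N \<longrightarrow> P t))"

definition S1 ::
  "('t::metric_space set \<Rightarrow> 'r::dedekind_complete_algebra) \<Rightarrow> ('t \<Rightarrow> 'r set) \<Rightarrow> ('t \<Rightarrow> 'r) set" where
  "S1 \<mu> F = {f. (\<exists>I. has_KH_integral \<mu> f UNIV I) \<and> ae \<mu> (\<lambda>t. f t \<in> F t)}"

text \<open>
  The integral over \<open>A\<close> enters as a relation rather than through a choice operator: if \<open>A\<close> is not
  compact, some gage admits no fine partition of \<open>A\<close>, and then the value is not unique.
\<close>

definition aumann_integral ::
  "('t::metric_space set \<Rightarrow> 'r::dedekind_complete_algebra) \<Rightarrow> ('t \<Rightarrow> 'r set) \<Rightarrow> 't set \<Rightarrow> 'r set" where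
  "aumann_integral \<mu> F A = {I. \<exists>f\<in>S1 \<mu> F. has_KH_integral \<mu> f A I}"

end

theory Submission
  imports Defs
begin

text \<open>
  Both integrals are compared with the set \<open>X\<close> of the values
  \<open>\<Sum>v\<in>range f. v * \<mu> (A \<inter> f -` {v})\<close>, where \<open>f\<close> ranges over the simple Borel functions with
  \<open>f t \<in> F t\<close> for all \<open>t\<close>.

  If \<open>A\<close> is not closed, then some gage admits no fine partition of \<open>A\<close>
  (\<open>ex_gage_without_fine_partition\<close>), so that both sides are the whole space.

  Let \<open>A\<close> be compact.  By regularity each level set of \<open>F\<close>, or of a simple function, contains a compact
  set that exhausts it up to a small remainder, and a gage whose balls avoid the compact sets in
  the other level sets makes tagged pieces lie essentially in one level set (\<open>lusin_gage\<close>).  Hence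
  simple selections are integrable with the expected integral (\<open>has_KH_integral_simple\<close>), and
  conversely every Riemann sum of \<open>F\<close> over a fine partition is close to an element of \<open>X\<close>
  (\<open>simple_selections_riemann_sum\<close>).  These two facts give that the \<open>(*)\<close>-integral is \<open>cl X\<close>, and that
  \<open>X\<close> is contained in the Aumann integral.

  It remains to see that the Aumann integral is contained in \<open>cl X\<close>.  An integrable function may leave \<open>F\<close> on
  a null set, where it may be unbounded and where a gage may force tags.  There are still fine
  partitions whose tags in the null set contribute little (\<open>fine_partition_few_null_tags\<close>); this
  uses continuity of \<open>\<mu>\<close> from above, which follows from regularity and the compactness of the space
  (\<open>order_null_measure_antimono\<close>).

  All limits are controlled by regulators.  In a super Dedekind complete, weakly
  \<open>\<sigma>\<close>-distributive space these may be replaced by decreasing sequences with infimum \<open>0\<close>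
  (\<open>D_sequence_iff_order_approx\<close>), and iterated limits of order bounded quantities collapse to
  single ones (\<open>order_approx_diagonal\<close>), which also makes \<open>cl\<close> idempotent on order bounded sets.
\<close>

section \<open>Order null sequences and regulators\<close>

definition order_null :: "(nat \<Rightarrow> 'a::dedekind_complete_riesz_space) \<Rightarrow> bool" where
  "order_null p \<longleftrightarrow> decseq p \<and> (\<forall>n. 0 \<le> p n) \<and> (\<forall>l. (\<forall>n. l \<le> p n) \<longrightarrow> l \<le> 0)"

text \<open>
  \<open>P\<close> holds for order-small elements.  Every notion of approximation below has the form
  "there is a regulator \<open>a\<close> such that \<open>P (SUP i. a i (\<phi> i))\<close> for all \<open>\<phi>\<close>", and for the
  upward closed \<open>P\<close> that occur this is the same property stated with a sequence in place of a regulator.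
\<close>

definition order_approx :: "('a::dedekind_complete_riesz_space \<Rightarrow> bool) \<Rightarrow> bool" where
  "order_approx P \<longleftrightarrow> (\<exists>p. order_null p \<and> (\<forall>n. P (p n)))"

lemma order_nullI:
  assumes "decseq p" "\<And>n. 0 \<le> p n" "\<And>l. (\<And>n. l \<le> p n) \<Longrightarrow> l \<le> 0"
  shows "order_null p"
  using assms unfolding order_null_def by blast

lemma order_null_decseq: "order_null p \<Longrightarrow> m \<le> n \<Longrightarrow> p n \<le> p m"
  by (rule decseqD) (simp_all add: order_null_def)

lemma order_null_nonneg: "order_null p \<Longrightarrow> 0 \<le> p n"
  unfolding order_null_def by blast

lemma order_null_le_0: "order_null p \<Longrightarrow> (\<And>n. l \<le> p n) \<Longrightarrow> l \<le> 0"
  unfolding order_null_def by blast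

lemma order_null_zero: "order_null (\<lambda>_. 0)"
  by (rule order_nullI) (auto simp: decseq_def)

lemma order_null_Inf:
  assumes "order_null p"
  shows "Inf (range p) = 0"
proof (rule cInf_eq_non_empty)
  show "0 \<le> x" if "x \<in> range p" for x
    using that order_null_nonneg[OF assms] by auto
  show "y \<le> 0" if "\<And>x. x \<in> range p \<Longrightarrow> y \<le> x" for y
    by (rule order_null_le_0[OF assms]) (auto intro: that)
qed simp

lemma order_null_add:
  assumes p: "order_null p" and q: "order_null q"
  shows "order_null (\<lambda>n. p n + q n)"
proof (rule order_nullI)
  show "decseq (\<lambda>n. p n + q n)"
    unfolding decseq_def by (auto intro!: add_mono order_null_decseq[OF p] order_null_decseq[OF q])
  show "0 \<le> p n + q n" for n
    by (intro add_nonneg_nonneg order_null_nonneg p q)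
  fix l assume l: "\<And>n. l \<le> p n + q n"
  have "l - q m \<le> 0" for m
  proof (rule order_null_le_0[OF p])
    fix n
    have "l \<le> p (max m n) + q (max m n)" by (rule l)
    also have "\<dots> \<le> p n + q m"
      by (intro add_mono order_null_decseq[OF p] order_null_decseq[OF q]) auto
    finally show "l - q m \<le> p n" by (simp add: algebra_simps)
  qed
  then have "l \<le> q m" for m by simp
  then show "l \<le> 0" by (rule order_null_le_0[OF q])
qed

lemma order_null_sum:
  assumes "\<And>k. k \<in> K \<Longrightarrow> order_null (p k)"
  shows "order_null (\<lambda>n. \<Sum>k\<in>K. p k n)"
proof (cases "finite K")
  case True
  then show ?thesis using assms
    by (induction K) (auto intro: order_null_zero order_null_add)
qed (simp add: order_null_zero)

lemma order_null_scaleR: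
  assumes p: "order_null p" and c: "0 < c"
  shows "order_null (\<lambda>n. c *\<^sub>R p n)"
proof (rule order_nullI)
  show "decseq (\<lambda>n. c *\<^sub>R p n)"
    unfolding decseq_def using c by (auto intro!: scaleR_left_mono order_null_decseq[OF p])
  show "0 \<le> c *\<^sub>R p n" for n
    using c order_null_nonneg[OF p] by (simp add: scaleR_nonneg_nonneg)
  fix l assume l: "\<And>n. l \<le> c *\<^sub>R p n"
  have "inverse c *\<^sub>R l \<le> p n" for n
    using scaleR_left_mono[OF l[of n], of "inverse c"] c by simp
  then have "inverse c *\<^sub>R l \<le> 0" by (rule order_null_le_0[OF p])
  then show "l \<le> 0"
    using scaleR_left_mono[of "inverse c *\<^sub>R l" 0 c] c by simp
qed

lemma order_null_inf:
  assumes p: "order_null p" and u: "0 \<le> u"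
  shows "order_null (\<lambda>n. inf (p n) u)"
proof (rule order_nullI)
  show "decseq (\<lambda>n. inf (p n) u)"
    unfolding decseq_def by (auto intro: le_infI1 order_null_decseq[OF p])
  show "0 \<le> inf (p n) u" for n
    using u order_null_nonneg[OF p] by simp
  show "l \<le> 0" if "\<And>n. l \<le> inf (p n) u" for l
    by (rule order_null_le_0[OF p]) (use that in simp)
qed

lemma D_sequenceI:
  assumes "\<And>i. order_null (a i)" and "\<And>i j. a i j \<le> b"
  shows "D_sequence a"
  unfolding D_sequence_def
proof (intro conjI exI allI)
  show "\<bar>a i j\<bar> \<le> b" for i j
    using assms(2) order_null_nonneg[OF assms(1)] by simp
  show "a i (Suc j) \<le> a i j" for i j
    by (rule order_null_decseq[OF assms(1)]) simp
  show "Inf (range (a i)) = 0" for i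
    by (rule order_null_Inf[OF assms(1)])
qed

lemma D_sequence_row_antimono: "D_sequence a \<Longrightarrow> j \<le> k \<Longrightarrow> a i k \<le> a i j"
  unfolding D_sequence_def using decseqD[OF decseq_SucI, of "a i"] by blast

lemma D_sequence_nonneg:
  assumes "D_sequence a"
  shows "0 \<le> a i j"
proof -
  obtain b where b: "\<And>i j. \<bar>a i j\<bar> \<le> b" and I: "Inf (range (a i)) = 0"
    using assms unfolding D_sequence_def by auto
  have "- b \<le> a i k" for k
    using b[of i k] by (simp add: abs_le_iff minus_le_iff)
  then have "bdd_below (range (a i))" by (intro bdd_belowI2)
  then show ?thesis using cInf_lower[of "a i j" "range (a i)"] I by auto
qed

lemma D_sequence_bdd_above:
  assumes "D_sequence a"
  shows "bdd_above (range (\<lambda>i. a i (\<phi> i)))"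
proof -
  obtain b where "\<And>i j. \<bar>a i j\<bar> \<le> b"
    using assms unfolding D_sequence_def by auto
  then have "a i (\<phi> i) \<le> b" for i
    by (metis abs_le_D1)
  then show ?thesis by (intro bdd_aboveI2)
qed

lemma D_sequence_le_SUP: "D_sequence a \<Longrightarrow> a i (\<phi> i) \<le> (SUP i. a i (\<phi> i))"
  by (rule cSUP_upper[OF _ D_sequence_bdd_above]) auto

lemma D_sequence_SUP_nonneg: "D_sequence a \<Longrightarrow> 0 \<le> (SUP i. a i (\<phi> i))"
  by (rule order_trans[OF D_sequence_nonneg D_sequence_le_SUP])

text \<open>
  The defining infimum of weak \<open>\<sigma>\<close>-distributivity, in the form in which it kills an error term.
\<close>

lemma weakly_sigma_distributive_le_0:
  fixes a :: "nat \<Rightarrow> nat \<Rightarrow> 'a::weakly_sigma_distributive_riesz_space"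
  assumes "D_sequence a" and "\<And>\<phi>. l \<le> (SUP i. a i (\<phi> i))"
  shows "l \<le> 0"
proof -
  have "l \<le> Inf (range (\<lambda>\<phi>::nat \<Rightarrow> nat. SUP i. a i (\<phi> i)))"
    by (rule cInf_greatest) (auto intro: assms(2))
  then show ?thesis using weakly_sigma_distributive[OF assms(1)] by simp
qed

text \<open>
  Regulators reduce to null sequences.  The bounds \<open>SUP i. a i (\<phi> i)\<close> have infimum \<open>0\<close> by weak
  \<open>\<sigma>\<close>-distributivity, super Dedekind completeness makes countably many \<open>\<psi> n\<close> suffice for this
  infimum, and since the rows of \<open>a\<close> decrease, the running maxima of the \<open>\<psi> n\<close> turn these countably
  many bounds into a decreasing sequence.
\<close>

lemma D_sequence_imp_order_null:
  fixes a :: "nat \<Rightarrow> nat \<Rightarrow>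
    'a::{super_dedekind_complete_riesz_space, weakly_sigma_distributive_riesz_space}"
  assumes a: "D_sequence a"
  obtains \<Phi> :: "nat \<Rightarrow> nat \<Rightarrow> nat" where "order_null (\<lambda>n. SUP i. a i (\<Phi> n i))"
proof -
  define s where "s = (\<lambda>\<phi>::nat \<Rightarrow> nat. SUP i. a i (\<phi> i))"
  have s0: "0 \<le> s \<phi>" for \<phi>
    unfolding s_def by (rule D_sequence_SUP_nonneg[OF a])
  \<comment> \<open>The countability axiom speaks of suprema, hence the sign.\<close>
  have bdd: "bdd_above (range (\<lambda>\<phi>. - s \<phi>))"
    using s0 by (intro bdd_aboveI[of _ 0]) auto
  then obtain B where B: "B \<subseteq> range (\<lambda>\<phi>. - s \<phi>)" "B \<noteq> {}" "countable B"
      "Sup B = Sup (range (\<lambda>\<phi>. - s \<phi>))"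
    using countable_subset_same_Sup[of "range (\<lambda>\<phi>. - s \<phi>)"] by auto
  have "- Sup B \<le> s \<phi>" for \<phi>
    using cSup_upper[OF _ bdd, of "- s \<phi>"] B(4) by (simp add: minus_le_iff)
  then have "- Sup B \<le> 0"
    unfolding s_def by (rule weakly_sigma_distributive_le_0[OF a])
  then have Sup0: "0 \<le> Sup B" by simp
  have "\<exists>\<psi>. from_nat_into B n = - s \<psi>" for n
    using from_nat_into[OF B(2), of n] B(1) by auto
  then obtain \<psi> where \<psi>: "\<And>n. from_nat_into B n = - s (\<psi> n)" by metis
  define \<Phi> where "\<Phi> = (\<lambda>n i. Max ((\<lambda>m. \<psi> m i) ` {..n}))"
  have mono: "s \<phi> \<le> s \<phi>'" if "\<And>i. \<phi>' i \<le> \<phi> i" for \<phi> \<phi>'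
    unfolding s_def
    by (rule cSUP_mono[OF _ D_sequence_bdd_above[OF a]])
      (auto intro: D_sequence_row_antimono[OF a] that)
  have "order_null (\<lambda>n. s (\<Phi> n))"
  proof (rule order_nullI)
    show "decseq (\<lambda>n. s (\<Phi> n))"
      unfolding decseq_def \<Phi>_def by (auto intro!: mono Max_mono)
    show "0 \<le> s (\<Phi> n)" for n by (rule s0)
    fix l assume l: "\<And>n. l \<le> s (\<Phi> n)"
    have "l \<le> s (\<psi> n)" for n
      by (rule order_trans[OF l[of n]], rule mono) (auto simp: \<Phi>_def)
    then have "from_nat_into B n \<le> - l" for n
      by (simp add: \<psi>)
    moreover have "B = range (from_nat_into B)"
      using B by (simp add: range_from_nat_into)
    ultimately have "b \<le> - l" if "b \<in> B" for b
      using that by (metis imageE)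
    then have "Sup B \<le> - l" by (rule cSup_least[OF B(2)])
    then show "l \<le> 0" using Sup0 order_trans by fastforce
  qed
  then show thesis using that unfolding s_def by blast
qed

text \<open>
  Conversely, a null sequence \<open>p\<close> repeated in every row is a regulator, and each of its bounds
  dominates an element of \<open>p\<close>.
\<close>

lemma D_sequence_iff_order_approx:
  fixes P :: "'a::{super_dedekind_complete_riesz_space, weakly_sigma_distributive_riesz_space} \<Rightarrow> bool"
  assumes mono: "\<And>r s. P r \<Longrightarrow> r \<le> s \<Longrightarrow> P s"
  shows "(\<exists>a. D_sequence a \<and> (\<forall>\<phi>. P (SUP i. a i (\<phi> i)))) \<longleftrightarrow> order_approx P"
proof
  assume "\<exists>a. D_sequence a \<and> (\<forall>\<phi>. P (SUP i. a i (\<phi> i)))"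
  then obtain a where a: "D_sequence a" and P: "\<And>\<phi>. P (SUP i. a i (\<phi> i))" by blast
  obtain \<Phi> where "order_null (\<lambda>n. SUP i. a i (\<Phi> n i))"
    using D_sequence_imp_order_null[OF a] by blast
  then show "order_approx P"
    unfolding order_approx_def using P by blast
next
  assume "order_approx P"
  then obtain p where p: "order_null p" "\<And>n. P (p n)"
    unfolding order_approx_def by auto
  have D: "D_sequence (\<lambda>i::nat. p)"
    by (rule D_sequenceI[of _ "p 0"]) (auto intro: p(1) order_null_decseq[OF p(1)])
  have "P (SUP i. p (\<phi> i))" for \<phi> :: "nat \<Rightarrow> nat"
    by (rule mono[OF p(2)[of "\<phi> 0"]]) (rule D_sequence_le_SUP[OF D])
  then show "\<exists>a. D_sequence a \<and> (\<forall>\<phi>. P (SUP i. a i (\<phi> i)))"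
    using D by (intro exI[of _ "\<lambda>i. p"]) auto
qed

lemma order_approxI: "order_null p \<Longrightarrow> (\<And>n. P (p n)) \<Longrightarrow> order_approx P"
  unfolding order_approx_def by blast

lemma order_approx_trivial: "(\<And>r. 0 \<le> r \<Longrightarrow> P r) \<Longrightarrow> order_approx P"
  by (rule order_approxI[OF order_null_zero]) auto

lemma order_approx_mono:
  assumes "order_approx P" and "\<And>r. 0 \<le> r \<Longrightarrow> P r \<Longrightarrow> Q r"
  shows "order_approx Q"
  using assms order_null_nonneg unfolding order_approx_def by blast

lemma order_approx_add:
  assumes "order_approx P" "order_approx Q"
    and "\<And>r s. 0 \<le> r \<Longrightarrow> 0 \<le> s \<Longrightarrow> P r \<Longrightarrow> Q s \<Longrightarrow> S (r + s)"
  shows "order_approx S"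
proof -
  obtain p where p: "order_null p" "\<And>n. P (p n)"
    using assms(1) unfolding order_approx_def by blast
  obtain q where q: "order_null q" "\<And>n. Q (q n)"
    using assms(2) unfolding order_approx_def by blast
  show ?thesis
  proof (rule order_approxI[OF order_null_add[OF p(1) q(1)]])
    show "S (p n + q n)" for n
      by (rule assms(3)) (simp_all add: p q order_null_nonneg)
  qed
qed

lemma order_approx_sum:
  assumes "\<And>k. k \<in> K \<Longrightarrow> order_approx (P k)"
    and "\<And>r. (\<And>k. k \<in> K \<Longrightarrow> P k (r k)) \<Longrightarrow> Q (\<Sum>k\<in>K. r k)"
  shows "order_approx Q"
proof -
  have "\<exists>p. order_null p \<and> (\<forall>n. P k (p n))" if "k \<in> K" for k
    using assms(1)[OF that] unfolding order_approx_def .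
  then obtain p where p: "\<And>k. k \<in> K \<Longrightarrow> order_null (p k)" "\<And>k n. k \<in> K \<Longrightarrow> P k (p k n)"
    by metis
  show ?thesis
    by (rule order_approxI[of "\<lambda>n. \<Sum>k\<in>K. p k n"]) (auto intro: order_null_sum p assms(2))
qed

text \<open>
  The counterpart of choosing a diagonal sequence.  Each outer error \<open>p n\<close> comes with its own null
  sequence \<open>w n\<close>.  Cut off at \<open>u\<close>, the double sequence \<open>w\<close> is bounded and thus a regulator, so that
  one null sequence of bounds controls a suitable entry in every row.  The truncation hypothesis on
  \<open>P\<close> is what allows the cut.
\<close>

lemma order_approx_diagonal:
  fixes P :: "'a::{super_dedekind_complete_riesz_space, weakly_sigma_distributive_riesz_space} \<Rightarrow> bool"
  assumes approx: "order_approx (\<lambda>r. order_approx (\<lambda>s. P (r + s)))"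
    and mono: "\<And>r s. P r \<Longrightarrow> r \<le> s \<Longrightarrow> P s"
    and trunc: "\<And>r. P r \<Longrightarrow> P (inf r u)" and u: "0 \<le> u"
  shows "order_approx P"
proof -
  obtain p where p: "order_null p" and "\<And>n. order_approx (\<lambda>s. P (p n + s))"
    using approx unfolding order_approx_def by blast
  then have "\<exists>w. order_null w \<and> (\<forall>m. P (p n + w m))" for n
    unfolding order_approx_def by blast
  then obtain w where w: "\<And>n. order_null (w n)" "\<And>n m. P (p n + w n m)"
    by metis
  define a where "a = (\<lambda>n m. inf (w n m) u)"
  have D: "D_sequence a"
    by (rule D_sequenceI[of _ u]) (auto simp: a_def intro: order_null_inf w u)
  then obtain \<Phi> where \<Phi>: "order_null (\<lambda>n. SUP i. a i (\<Phi> n i))"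
    by (rule D_sequence_imp_order_null)
  show ?thesis
  proof (rule order_approxI[OF order_null_add[OF p \<Phi>]])
    fix n
    have "inf (p n + w n (\<Phi> n n)) u \<le> inf (p n + w n (\<Phi> n n)) (p n + u)"
      using order_null_nonneg[OF p, of n] by (intro inf_mono) auto
    also have "\<dots> = p n + a n (\<Phi> n n)"
      by (simp add: a_def add_inf_distrib_left)
    also have "\<dots> \<le> p n + (SUP i. a i (\<Phi> n i))"
      using D_sequence_le_SUP[OF D] by (rule add_left_mono)
    finally show "P (p n + (SUP i. a i (\<Phi> n i)))"
      using mono[OF trunc[OF w(2)]] by blast
  qed
qed

lemma in_cl_iff:
  fixes X :: "'a::{super_dedekind_complete_riesz_space, weakly_sigma_distributive_riesz_space} set"
  shows "z \<in> cl X \<longleftrightarrow> order_approx (\<lambda>r. \<exists>x\<in>X. \<bar>x - z\<bar> \<le> r)"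
proof -
  have "z \<in> cl X \<longleftrightarrow> (\<exists>a. D_sequence a \<and> (\<forall>\<phi>. \<exists>x\<in>X. \<bar>x - z\<bar> \<le> (SUP i. a i (\<phi> i))))"
    unfolding cl_def U_nbhd_def by auto
  also have "\<dots> \<longleftrightarrow> order_approx (\<lambda>r. \<exists>x\<in>X. \<bar>x - z\<bar> \<le> r)"
    by (rule D_sequence_iff_order_approx) (meson order_trans)
  finally show ?thesis .
qed

lemma subset_cl:
  fixes X :: "'a::{super_dedekind_complete_riesz_space, weakly_sigma_distributive_riesz_space} set"
  shows "X \<subseteq> cl X"
proof
  fix z assume "z \<in> X"
  then have "\<exists>x\<in>X. \<bar>x - z\<bar> \<le> r" if "0 \<le> r" for r
    using that by (intro bexI[of _ z]) auto
  then show "z \<in> cl X"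
    unfolding in_cl_iff by (rule order_approx_trivial)
qed

lemma cl_mono:
  fixes X :: "'a::{super_dedekind_complete_riesz_space, weakly_sigma_distributive_riesz_space} set"
  assumes "X \<subseteq> Y"
  shows "cl X \<subseteq> cl Y"
proof
  fix z assume "z \<in> cl X"
  then show "z \<in> cl Y"
    unfolding in_cl_iff by (rule order_approx_mono) (use assms in blast)
qed

lemma abs_diff_le_inf:
  fixes x z H :: "'a::dedekind_complete_riesz_space"
  assumes "\<bar>x\<bar> \<le> H" "\<bar>x - z\<bar> \<le> r"
  shows "\<bar>x - z\<bar> \<le> inf r (\<bar>H\<bar> + \<bar>z\<bar>)"
proof -
  have "\<bar>x - z\<bar> \<le> \<bar>x\<bar> + \<bar>z\<bar>" by (rule abs_triangle_ineq4)
  also have "\<dots> \<le> \<bar>H\<bar> + \<bar>z\<bar>"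
    using order_trans[OF assms(1) abs_ge_self] by (rule add_right_mono)
  finally show ?thesis using assms(2) by simp
qed

text \<open>
  An order bounded set provides the truncation needed for the diagonal argument: distances from \<open>z\<close>
  never exceed \<open>\<bar>H\<bar> + \<bar>z\<bar>\<close>.
\<close>

lemma in_cl_diagonal:
  fixes X :: "'a::{super_dedekind_complete_riesz_space, weakly_sigma_distributive_riesz_space} set"
  assumes bdd: "\<And>x. x \<in> X \<Longrightarrow> \<bar>x\<bar> \<le> H"
    and approx: "order_approx (\<lambda>r. order_approx (\<lambda>s. \<exists>x\<in>X. \<bar>x - z\<bar> \<le> r + s))"
  shows "z \<in> cl X"
  unfolding in_cl_iff
proof (rule order_approx_diagonal[OF approx, where u = "\<bar>H\<bar> + \<bar>z\<bar>"])
  show "\<exists>x\<in>X. \<bar>x - z\<bar> \<le> s" if "\<exists>x\<in>X. \<bar>x - z\<bar> \<le> r" "r \<le> s" for r s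
    using that order_trans by blast
  show "\<exists>x\<in>X. \<bar>x - z\<bar> \<le> inf r (\<bar>H\<bar> + \<bar>z\<bar>)" if "\<exists>x\<in>X. \<bar>x - z\<bar> \<le> r" for r
    using that abs_diff_le_inf bdd by blast
qed simp

lemma cl_cl_subset:
  fixes X :: "'a::{super_dedekind_complete_riesz_space, weakly_sigma_distributive_riesz_space} set"
  assumes bdd: "\<And>x. x \<in> X \<Longrightarrow> \<bar>x\<bar> \<le> H"
  shows "cl (cl X) \<subseteq> cl X"
proof
  fix z assume "z \<in> cl (cl X)"
  then have "order_approx (\<lambda>r. order_approx (\<lambda>s. \<exists>x\<in>X. \<bar>x - z\<bar> \<le> r + s))"
    unfolding in_cl_iff[of z "cl X"]
  proof (rule order_approx_mono)
    fix r assume "\<exists>y\<in>cl X. \<bar>y - z\<bar> \<le> r"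
    then obtain y where y: "order_approx (\<lambda>s. \<exists>x\<in>X. \<bar>x - y\<bar> \<le> s)" "\<bar>y - z\<bar> \<le> r"
      using in_cl_iff[of _ X] by blast
    show "order_approx (\<lambda>s. \<exists>x\<in>X. \<bar>x - z\<bar> \<le> r + s)"
      using y(1)
    proof (rule order_approx_mono)
      fix s assume "\<exists>x\<in>X. \<bar>x - y\<bar> \<le> s"
      then obtain x where x: "x \<in> X" "\<bar>x - y\<bar> \<le> s" by blast
      have "\<bar>x - z\<bar> \<le> \<bar>x - y\<bar> + \<bar>y - z\<bar>"
        using abs_triangle_ineq[of "x - y" "y - z"] by simp
      also have "\<dots> \<le> r + s" using add_mono[OF x(2) y(2)] by (simp add: add.commute)
      finally show "\<exists>x\<in>X. \<bar>x - z\<bar> \<le> r + s" using x(1) by blast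
    qed
  qed
  then show "z \<in> cl X" using in_cl_diagonal[OF bdd] by blast
qed

section \<open>Suprema of truncations, and products\<close>

text \<open>
  The infinite distributive law of lattice ordered groups; it rests on the decomposition
  \<open>x = inf x u + sup 0 (x - u)\<close>, whose second summand is monotone in \<open>x\<close>.
\<close>

lemma inf_Sup_le:
  fixes Q :: "'a::dedekind_complete_riesz_space set"
  assumes "Q \<noteq> {}" "bdd_above Q" and s: "\<And>q. q \<in> Q \<Longrightarrow> inf q u \<le> s"
  shows "inf (Sup Q) u \<le> s"
proof -
  have eq: "x = inf x u + sup 0 (x - u)" for x
  proof -
    have "x - inf x u = sup (x + - x) (x + - u)"
      by (simp only: diff_inf_eq_sup add_sup_distrib_left)
    then have "x - inf x u = sup 0 (x - u)"
      by (simp only: right_minus diff_conv_add_uminus)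
    then show ?thesis by (simp only: diff_eq_eq add.commute)
  qed
  have "q \<le> s + sup 0 (Sup Q - u)" if "q \<in> Q" for q
  proof -
    have "q = inf q u + sup 0 (q - u)" by (rule eq)
    also have "\<dots> \<le> s + sup 0 (Sup Q - u)"
      using that assms by (intro add_mono s sup_mono diff_right_mono cSup_upper) auto
    finally show ?thesis .
  qed
  then have "Sup Q \<le> s + sup 0 (Sup Q - u)" by (rule cSup_least[OF assms(1)])
  then have "inf (Sup Q) u + sup 0 (Sup Q - u) \<le> s + sup 0 (Sup Q - u)"
    using eq[of "Sup Q"] by simp
  then show ?thesis by simp
qed

lemma sum_half_powers_le_1: "(\<Sum>i\<le>m. inverse (2 ^ Suc i)) \<le> (1::real)"
proof -
  have "(\<Sum>i\<le>m. inverse (2 ^ Suc i)) = 1 - inverse (2 ^ Suc m :: real)"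
    by (induction m) (simp_all add: field_simps)
  then show ?thesis by simp
qed

text \<open>
  Replaces sums by suprema: with weights \<open>2 ^ Suc i\<close>, a sum becomes a dominated convex combination.
  The cut at \<open>u\<close> is essential, because the weighted terms form a regulator only after truncation.
\<close>

lemma inf_sum_le_of_dyadic:
  fixes p :: "nat \<Rightarrow> 'a::dedekind_complete_riesz_space"
  assumes p: "\<And>i. 0 \<le> p i" and s: "\<And>i. inf (2 ^ Suc i *\<^sub>R p i) u \<le> s"
  shows "inf (\<Sum>i\<le>m. p i) u \<le> s"
proof -
  define Q where "Q = (\<lambda>i. 2 ^ Suc i *\<^sub>R p i) ` {..m}"
  have Q: "Q \<noteq> {}" "bdd_above Q" unfolding Q_def by auto
  have "0 \<le> 2 ^ Suc 0 *\<^sub>R p 0" by (simp add: p scaleR_nonneg_nonneg)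
  also have "\<dots> \<le> Sup Q" by (rule cSup_upper[OF _ Q(2)]) (unfold Q_def, rule imageI, simp)
  finally have z: "0 \<le> Sup Q" .
  have "p i \<le> inverse (2 ^ Suc i) *\<^sub>R Sup Q" if "i \<le> m" for i
  proof -
    have "2 ^ Suc i *\<^sub>R p i \<le> Sup Q"
      by (rule cSup_upper[OF _ Q(2)]) (use that in \<open>auto simp: Q_def\<close>)
    from scaleR_left_mono[OF this, of "inverse (2 ^ Suc i)"] show ?thesis by simp
  qed
  then have "(\<Sum>i\<le>m. p i) \<le> (\<Sum>i\<le>m. inverse (2 ^ Suc i) *\<^sub>R Sup Q)"
    by (intro sum_mono) auto
  also have "\<dots> = (\<Sum>i\<le>m. inverse (2 ^ Suc i)) *\<^sub>R Sup Q"
    by (simp only: scaleR_sum_left)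
  also have "\<dots> \<le> 1 *\<^sub>R Sup Q"
    by (rule scaleR_right_mono[OF sum_half_powers_le_1 z])
  finally have "inf (\<Sum>i\<le>m. p i) u \<le> inf (Sup Q) u"
    by (intro inf_mono) simp_all
  also have "\<dots> \<le> s"
    by (rule inf_Sup_le[OF Q]) (use s in \<open>auto simp: Q_def\<close>)
  finally show ?thesis .
qed

lemma zero_prod [simp]: "0 * c = (0::'r::dedekind_complete_algebra)"
  using prod_add_left[of 0 0 c] by simp

lemma prod_zero [simp]: "c * 0 = (0::'r::dedekind_complete_algebra)"
  using prod_add_right[of c 0 0] by simp

lemma prod_minus_left: "- x * c = - (x * (c::'r::dedekind_complete_algebra))"
  using prod_add_left[of "- x" x c] by (simp add: eq_neg_iff_add_eq_0)

lemma prod_diff_left: "(x - y) * c = x * c - y * (c::'r::dedekind_complete_algebra)"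
  using prod_add_left[of x "- y" c] by (simp add: prod_minus_left)

lemma prod_nonneg: "0 \<le> x \<Longrightarrow> 0 \<le> c \<Longrightarrow> 0 \<le> x * (c::'r::dedekind_complete_algebra)"
  using prod_mono_left[of 0 x c] by simp

lemma prod_sum_left:
  fixes x :: "'i \<Rightarrow> 'r::dedekind_complete_algebra"
  shows "(\<Sum>i\<in>I. x i) * c = (\<Sum>i\<in>I. x i * c)"
  by (induction I rule: infinite_finite_induct) (simp_all add: prod_add_left)

lemma prod_sum_right:
  fixes x :: "'i \<Rightarrow> 'r::dedekind_complete_algebra"
  shows "c * (\<Sum>i\<in>I. x i) = (\<Sum>i\<in>I. c * x i)"
  by (induction I rule: infinite_finite_induct) (simp_all add: prod_add_right)

lemma abs_prod_le:
  fixes x c :: "'r::dedekind_complete_algebra"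
  assumes "\<bar>x\<bar> \<le> H" "0 \<le> c"
  shows "\<bar>x * c\<bar> \<le> H * c"
proof (rule abs_leI)
  have H: "x \<le> H" "- x \<le> H" using assms(1) by (simp_all add: abs_le_iff)
  show "x * c \<le> H * c" by (rule prod_mono_left[OF H(1) assms(2)])
  show "- (x * c) \<le> H * c"
    using prod_mono_left[OF H(2) assms(2)] by (simp add: prod_minus_left)
qed

text \<open>
  This is where the order continuity of the product enters: the range of a null sequence is a
  downward directed set with infimum \<open>0\<close>.
\<close>

lemma order_null_prod:
  fixes p :: "nat \<Rightarrow> 'r::dedekind_complete_algebra"
  assumes p: "order_null p" and c: "0 \<le> c"
  shows "order_null (\<lambda>n. c * p n)"
proof (rule order_nullI)
  show "decseq (\<lambda>n. c * p n)"
    unfolding decseq_def by (auto intro: prod_mono_right order_null_decseq[OF p] c)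
  show nonneg: "0 \<le> c * p n" for n
    by (rule prod_nonneg[OF c order_null_nonneg[OF p]])
  fix l assume l: "\<And>n. l \<le> c * p n"
  have "Inf ((\<lambda>x. c * x) ` range p) = 0"
  proof (rule prod_continuous_left[OF _ _ _ order_null_Inf[OF p] c])
    fix x y assume "x \<in> range p" "y \<in> range p"
    then obtain i j where ij: "x = p i" "y = p j" by blast
    have "p (max i j) \<le> x \<and> p (max i j) \<le> y"
      unfolding ij by (auto intro: order_null_decseq[OF p])
    then show "\<exists>z\<in>range p. z \<le> x \<and> z \<le> y" by blast
  next
    show "bdd_below (range p)" by (rule bdd_belowI2) (rule order_null_nonneg[OF p])
  qed simp
  moreover have "l \<le> Inf ((\<lambda>x. c * x) ` range p)"
    by (rule cInf_greatest) (auto intro: l)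
  ultimately show "l \<le> 0" by simp
qed

lemma order_approx_prod:
  fixes c :: "'r::dedekind_complete_algebra"
  assumes "order_approx P" and "0 \<le> c" and "\<And>r. 0 \<le> r \<Longrightarrow> P r \<Longrightarrow> Q (c * r)"
  shows "order_approx Q"
proof -
  obtain p where p: "order_null p" "\<And>n. P (p n)"
    using assms(1) unfolding order_approx_def by blast
  show ?thesis
    by (rule order_approxI[OF order_null_prod[OF p(1) assms(2)]])
      (intro assms(3) p(2) order_null_nonneg[OF p(1)])
qed

section \<open>Regular additive mappings\<close>

locale regular_additive =
  fixes \<mu> :: "'t::metric_space set \<Rightarrow>
      'r::{super_dedekind_complete_riesz_space, weakly_sigma_distributive_riesz_space,
           dedekind_complete_algebra}"
  assumes compact_space: "compact (UNIV :: 't set)"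
    and nonneg: "S \<in> sets borel \<Longrightarrow> 0 \<le> \<mu> S"
    and additive: "additive (sets borel) \<mu>"
    and regular: "regular_mapping \<mu>"
begin

lemma measure_Un:
  assumes "S \<in> sets borel" "S' \<in> sets borel" "S \<inter> S' = {}"
  shows "\<mu> (S \<union> S') = \<mu> S + \<mu> S'"
  using additiveD[OF additive assms(3,1,2)] .

lemma measure_empty [simp]: "\<mu> {} = 0"
  using measure_Un[of "{}" "{}"] by simp

lemma measure_split:
  assumes "S \<in> sets borel" "B \<in> sets borel"
  shows "\<mu> S = \<mu> (S \<inter> B) + \<mu> (S - B)"
  using measure_Un[of "S \<inter> B" "S - B"] assms by (simp add: Int_Diff_Un Int_Diff_disjoint)

lemma measure_mono:
  assumes "S \<in> sets borel" "S' \<in> sets borel" "S \<subseteq> S'"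
  shows "\<mu> S \<le> \<mu> S'"
  using measure_split[OF assms(2,1)] nonneg[of "S' - S"] assms
  by (simp add: inf.absorb2)

lemma measure_Union_disjoint:
  assumes "finite I" "\<And>i. i \<in> I \<Longrightarrow> D i \<in> sets borel" "disjoint_family_on D I"
  shows "\<mu> (\<Union>i\<in>I. D i) = (\<Sum>i\<in>I. \<mu> (D i))"
  using assms
proof (induction I)
  case (insert i I)
  have "D i \<inter> D j = {}" if "j \<in> I" for j
    using disjoint_family_onD[OF insert.prems(2), of i j] that insert.hyps(2) by auto
  then have "D i \<inter> (\<Union>j\<in>I. D j) = {}" by blast
  moreover have "disjoint_family_on D I"
    by (rule disjoint_family_on_mono[OF _ insert.prems(2)]) auto
  ultimately show ?case
    using insert by (simp add: measure_Un sets.finite_UN)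
qed simp

lemma measure_Un_le:
  assumes "S \<in> sets borel" "S' \<in> sets borel"
  shows "\<mu> (S \<union> S') \<le> \<mu> S + \<mu> S'"
proof -
  have "\<mu> (S \<union> S') = \<mu> S + \<mu> (S' - S)"
    using measure_Un[of S "S' - S"] assms by simp
  also have "\<dots> \<le> \<mu> S + \<mu> S'"
    using assms by (intro add_left_mono measure_mono) auto
  finally show ?thesis .
qed

lemma measure_Union_le:
  assumes "finite I" "\<And>i. i \<in> I \<Longrightarrow> D i \<in> sets borel"
  shows "\<mu> (\<Union>i\<in>I. D i) \<le> (\<Sum>i\<in>I. \<mu> (D i))"
  using assms
proof (induction I)
  case (insert i I)
  have "\<mu> (\<Union>j\<in>insert i I. D j) \<le> \<mu> (D i) + \<mu> (\<Union>j\<in>I. D j)"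
    using insert by (simp add: measure_Un_le sets.finite_UN)
  also have "\<dots> \<le> \<mu> (D i) + (\<Sum>j\<in>I. \<mu> (D j))"
    using insert by (intro add_left_mono) auto
  finally show ?case using insert by simp
qed simp

lemma measure_null_subset:
  assumes "S \<in> sets borel" "N \<in> sets borel" "S \<subseteq> N" "\<mu> N = 0"
  shows "\<mu> S = 0"
  using measure_mono[OF assms(1-3)] nonneg[OF assms(1)] assms(4) by simp

text \<open>
  Compact subsets are enough to construct gages: the open neighbourhoods of a level set of a simple
  function are obtained as complements of compact subsets of the other level sets.
\<close>

lemma inner_regular:
  assumes "S \<in> sets borel"
  shows "order_approx (\<lambda>r. \<exists>K. compact K \<and> K \<subseteq> S \<and> \<mu> (S - K) \<le> r)"
proof -
  let ?P = "\<lambda>r. \<exists>K. compact K \<and> K \<subseteq> S \<and> \<mu> (S - K) \<le> r"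
  have mono: "?P s" if "?P r" "r \<le> s" for r s
    using that order_trans[OF _ that(2)] by blast
  obtain a where a: "D_sequence a"
      and KU: "\<And>\<phi>. \<exists>K U. compact K \<and> open U \<and> K \<subseteq> S \<and> S \<subseteq> U \<and> \<mu> (U - K) \<le> (SUP i. a i (\<phi> i))"
    using regular[unfolded regular_mapping_def, rule_format, OF assms] by blast
  have "?P (SUP i. a i (\<phi> i))" for \<phi>
  proof -
    obtain K U where K: "compact K" "open U" "K \<subseteq> S" "S \<subseteq> U" "\<mu> (U - K) \<le> (SUP i. a i (\<phi> i))"
      using KU[of \<phi>] by (elim exE conjE)
    have "\<mu> (S - K) \<le> \<mu> (U - K)"
      using K assms by (intro measure_mono) (auto intro: borel_compact borel_open)
    also note K(5)
    finally show ?thesis using K(1,3) by (intro exI[of _ K] conjI)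
  qed
  then have "\<exists>a. D_sequence a \<and> (\<forall>\<phi>. ?P (SUP i. a i (\<phi> i)))"
    using a by (intro exI[of _ a] conjI allI)
  then show ?thesis
    by (subst (asm) D_sequence_iff_order_approx[of ?P, OF mono])
qed

text \<open>
  Continuity from above, although \<open>\<mu>\<close> is only finitely additive.  Compact sets \<open>K i \<subseteq> D i - N\<close> have empty
  intersection, so finitely many already do, and then \<open>D m - N\<close> is covered by the remainders
  \<open>D i - N - K i\<close> with \<open>i \<le> m\<close>.  The index \<open>m\<close> depends on the choice of the accuracies \<open>\<phi> i\<close> of the \<open>K i\<close>, but
  the sum of the remainders is bounded by the value at \<open>\<phi>\<close> of a single regulator \<open>a\<close>, and these values
  have infimum \<open>0\<close>.
\<close>

lemma order_null_measure_antimono: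
  assumes D: "\<And>m. D m \<in> sets borel" "decseq D" and N: "N \<in> sets borel" "\<mu> N = 0"
    and Inter: "(\<Inter>m. D m) \<subseteq> N"
  shows "order_null (\<lambda>m. \<mu> (D m))"
proof (rule order_nullI)
  show "decseq (\<lambda>m. \<mu> (D m))"
    unfolding decseq_def by (intro allI impI measure_mono D(1) decseqD[OF D(2)])
  show "0 \<le> \<mu> (D m)" for m by (rule nonneg[OF D(1)])
  fix l assume l: "\<And>m. l \<le> \<mu> (D m)"
  define u where "u = \<mu> UNIV"
  have u: "0 \<le> u" unfolding u_def by (rule nonneg) simp
  have "\<forall>i. \<exists>p. order_null p \<and> (\<forall>j. \<exists>K. compact K \<and> K \<subseteq> D i - N \<and> \<mu> (D i - N - K) \<le> p j)"
    using inner_regular[OF sets.Diff[OF D(1) N(1)]] unfolding order_approx_def by blast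
  then obtain p where p: "\<And>i. order_null (p i)"
      "\<And>i j. \<exists>K. compact K \<and> K \<subseteq> D i - N \<and> \<mu> (D i - N - K) \<le> p i j"
    by (subst (asm) choice_iff) blast
  define a where "a = (\<lambda>i j. inf (2 ^ Suc i *\<^sub>R p i j) u)"
  have a: "D_sequence a"
    unfolding a_def
    by (rule D_sequenceI[of _ u]) (auto intro!: order_null_inf order_null_scaleR p u)
  show "l \<le> 0"
  proof (rule weakly_sigma_distributive_le_0[OF a])
    fix \<phi> :: "nat \<Rightarrow> nat"
    let ?s = "SUP i. a i (\<phi> i)"
    have "\<forall>i. \<exists>K. compact K \<and> K \<subseteq> D i - N \<and> \<mu> (D i - N - K) \<le> p i (\<phi> i)"
      using p(2) by blast
    then obtain K where K: "\<And>i. compact (K i)" "\<And>i. K i \<subseteq> D i - N" "\<And>i. \<mu> (D i - N - K i) \<le> p i (\<phi> i)"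
      by (subst (asm) choice_iff) blast
    have "(\<Inter>i. K i) = {}"
      using K(2) Inter by blast
    then obtain I where I: "finite I" "(\<Inter>i\<in>I. K i) = {}"
      using compact_imp_fip_image[OF compact_space, of UNIV K] compact_imp_closed[OF K(1)]
      unfolding Int_UNIV_left by blast
    define m where "m = Max (insert 0 I)"
    have "D m - N \<subseteq> (\<Union>i\<in>{..m}. D i - N - K i)"
    proof
      fix x assume x: "x \<in> D m - N"
      obtain i where i: "i \<in> I" "x \<notin> K i" using I(2) by blast
      then have "i \<le> m" unfolding m_def using I(1) by simp
      then have "x \<in> D i" using x decseqD[OF D(2)] by blast
      then show "x \<in> (\<Union>i\<in>{..m}. D i - N - K i)" using x i \<open>i \<le> m\<close> by blast
    qed
    moreover have meas: "D i - N - K i \<in> sets borel" for i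
      using D(1) N(1) K(1) by (auto intro: borel_compact)
    ultimately have "\<mu> (D m - N) \<le> \<mu> (\<Union>i\<in>{..m}. D i - N - K i)"
      using D(1) N(1) by (intro measure_mono) auto
    also have "\<dots> \<le> (\<Sum>i\<le>m. \<mu> (D i - N - K i))"
      by (rule measure_Union_le) (use meas in auto)
    also have "\<dots> \<le> (\<Sum>i\<le>m. p i (\<phi> i))"
      by (intro sum_mono K(3))
    finally have "\<mu> (D m - N) \<le> (\<Sum>i\<le>m. p i (\<phi> i))" .
    moreover have "\<mu> (D m) = \<mu> (D m - N)"
      using measure_split[OF D(1) N(1), of m] measure_null_subset[of "D m \<inter> N" N] D(1) N by simp
    ultimately have "l \<le> (\<Sum>i\<le>m. p i (\<phi> i))" using l[of m] by simp
    moreover have "l \<le> u"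
      unfolding u_def using l[of 0] measure_mono[OF D(1), of UNIV 0] by (simp add: order_trans)
    moreover have "inf (\<Sum>i\<le>m. p i (\<phi> i)) u \<le> ?s"
    proof (rule inf_sum_le_of_dyadic)
      show "0 \<le> p i (\<phi> i)" for i by (rule order_null_nonneg[OF p(1)])
      show "inf (2 ^ Suc i *\<^sub>R p i (\<phi> i)) u \<le> ?s" for i
        using D_sequence_le_SUP[OF a, of i \<phi>] by (simp only: a_def)
    qed
    ultimately show "l \<le> ?s" using order_trans[OF le_infI] by blast
  qed
qed

text \<open>
  A version of Lusin's theorem: the level sets of \<open>\<kappa>\<close> contain compact sets \<open>K v\<close> that exhaust the space
  up to a small set \<open>W\<close>, and the ball around \<open>t\<close> is chosen to miss every \<open>K v\<close> with \<open>v \<noteq> \<kappa> t\<close>.  So a piece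
  of a fine partition lies in the level set of its tag up to points of \<open>W\<close>.  It is applied both
  to simple functions and to the multifunction itself, regarded as a function into sets.
\<close>

lemma lusin_gage:
  assumes \<kappa>: "simple_function borel \<kappa>"
  shows "order_approx (\<lambda>r. \<exists>\<gamma> W. gage \<gamma> \<and> W \<in> sets borel \<and> \<mu> W \<le> r \<and>
    (\<forall>t w. dist w t < \<gamma> t \<longrightarrow> \<kappa> w \<noteq> \<kappa> t \<longrightarrow> w \<in> W))"
proof (rule order_approx_sum[where K = "range \<kappa>"])
  let ?L = "\<lambda>v. \<kappa> -` {v}"
  have fin: "finite (range \<kappa>)" and meas: "\<And>v. ?L v \<in> sets borel"
    using simple_functionD[OF \<kappa>] by simp_all
  show "order_approx (\<lambda>r. \<exists>K. compact K \<and> K \<subseteq> ?L v \<and> \<mu> (?L v - K) \<le> r)" for v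
    by (rule inner_regular[OF meas])
  fix r assume "\<And>v. v \<in> range \<kappa> \<Longrightarrow> \<exists>K. compact K \<and> K \<subseteq> ?L v \<and> \<mu> (?L v - K) \<le> r v"
  then have "\<forall>v\<in>range \<kappa>. \<exists>K. compact K \<and> K \<subseteq> ?L v \<and> \<mu> (?L v - K) \<le> r v" by blast
  then obtain K where K: "\<And>v. v \<in> range \<kappa> \<Longrightarrow> compact (K v)"
      "\<And>v. v \<in> range \<kappa> \<Longrightarrow> K v \<subseteq> ?L v" "\<And>v. v \<in> range \<kappa> \<Longrightarrow> \<mu> (?L v - K v) \<le> r v"
    by (subst (asm) bchoice_iff) blast
  define W where "W = (\<Union>v\<in>range \<kappa>. ?L v - K v)"
  define G where "G = (\<lambda>t. \<Inter>v\<in>range \<kappa> - {\<kappa> t}. - K v)"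
  have "open (G t)" for t
    unfolding G_def using fin K(1) by (intro open_INT) (auto intro: compact_imp_closed)
  moreover have "t \<in> G t" for t
    unfolding G_def using K(2) by fastforce
  ultimately have "\<exists>e>0. ball t e \<subseteq> G t" for t
    by (simp add: open_contains_ball)
  then have "\<forall>t. \<exists>e>0. ball t e \<subseteq> G t" by blast
  then obtain \<gamma> where \<gamma>: "\<And>t. 0 < \<gamma> t" "\<And>t. ball t (\<gamma> t) \<subseteq> G t"
    by (subst (asm) choice_iff) blast
  have "w \<in> W" if "dist w t < \<gamma> t" "\<kappa> w \<noteq> \<kappa> t" for t w
  proof -
    have "w \<in> G t" using \<gamma>(2)[of t] that(1) by (auto simp: dist_commute)
    then have "w \<notin> K (\<kappa> w)" using that(2) unfolding G_def by auto
    then show ?thesis unfolding W_def by auto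
  qed
  moreover have measW: "?L v - K v \<in> sets borel" if "v \<in> range \<kappa>" for v
    using meas K(1)[OF that] by (auto intro: borel_compact)
  moreover have "W \<in> sets borel"
    unfolding W_def using fin measW by (intro sets.finite_UN) auto
  moreover have "\<mu> W \<le> (\<Sum>v\<in>range \<kappa>. r v)"
  proof -
    have "\<mu> W \<le> (\<Sum>v\<in>range \<kappa>. \<mu> (?L v - K v))"
      unfolding W_def using fin measW by (intro measure_Union_le) auto
    also have "\<dots> \<le> (\<Sum>v\<in>range \<kappa>. r v)" by (intro sum_mono K(3))
    finally show ?thesis .
  qed
  ultimately show "\<exists>\<gamma> W. gage \<gamma> \<and> W \<in> sets borel \<and> \<mu> W \<le> (\<Sum>v\<in>range \<kappa>. r v) \<and>
      (\<forall>t w. dist w t < \<gamma> t \<longrightarrow> \<kappa> w \<noteq> \<kappa> t \<longrightarrow> w \<in> W)"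
    using \<gamma>(1) unfolding gage_def by (intro exI[of _ \<gamma>] exI[of _ W]) auto
qed

end

section \<open>Simple functions and partitions\<close>

definition simple_int ::
  "('t::metric_space set \<Rightarrow> 'r::dedekind_complete_algebra) \<Rightarrow> ('t \<Rightarrow> 'r) \<Rightarrow> 't set \<Rightarrow> 'r" where
  "simple_int \<mu> f S = (\<Sum>v\<in>range f. v * \<mu> (S \<inter> f -` {v}))"

definition simple_selections :: "('t::metric_space \<Rightarrow> 'r set) \<Rightarrow> ('t \<Rightarrow> 'r) set" where
  "simple_selections F = {f. simple_function borel f \<and> (\<forall>t. f t \<in> F t)}"

lemma simple_function_borelD:
  assumes "simple_function borel f"
  shows "finite (range f)" "f -` V \<in> sets borel"
  using simple_functionD[OF assms] by simp_all

lemma simple_function_bounded: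
  fixes f :: "'t::metric_space \<Rightarrow> 'r::dedekind_complete_riesz_space"
  assumes "simple_function borel f"
  obtains H where "0 \<le> H" "\<And>t. \<bar>f t\<bar> \<le> H"
proof
  show "0 \<le> (\<Sum>v\<in>range f. \<bar>v\<bar>)" by (intro sum_nonneg) simp
  show "\<bar>f t\<bar> \<le> (\<Sum>v\<in>range f. \<bar>v\<bar>)" for t
    using sum_mono2[of "range f" "{f t}" abs] simple_function_borelD(1)[OF assms] by simp
qed

text \<open>
  Numbering the pieces by a simple function lets functions defined piecewise be recognised as
  compositions of simple functions.
\<close>

lemma ex_simple_index:
  fixes D :: "nat \<Rightarrow> 't::metric_space set"
  assumes "finite I" "\<And>i. i \<in> I \<Longrightarrow> D i \<in> sets borel" "disjoint_family_on D I"
  obtains \<iota> :: "'t \<Rightarrow> nat" where "simple_function borel \<iota>" "\<And>i w. i \<in> I \<Longrightarrow> w \<in> D i \<Longrightarrow> \<iota> w = i"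
proof
  show "simple_function borel (\<lambda>w. \<Sum>i\<in>I. i * indicator (D i) w)"
    using assms(2) by (intro simple_function_sum simple_function_mult) auto
  fix i w assume i: "i \<in> I" "w \<in> D i"
  have "w \<notin> D j" if "j \<in> I" "j \<noteq> i" for j
    using disjoint_family_onD[OF assms(3) i(1) that(1)] that(2) i(2) by auto
  then have "(\<Sum>j\<in>I. j * indicator (D j) w) = (\<Sum>j\<in>I. if j = i then i else 0)"
    using i by (intro sum.cong) auto
  also have "\<dots> = i" using assms(1) i(1) by simp
  finally show "(\<Sum>j\<in>I. j * indicator (D j) w) = i" .
qed

lemma ex_disjoint_pieces:
  assumes "finite P" "\<And>t. t \<in> P \<Longrightarrow> V t \<in> sets M" "B \<in> sets M" "B \<subseteq> (\<Union>t\<in>P. V t)"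
  shows "\<exists>D. (\<forall>t\<in>P. D t \<in> sets M \<and> D t \<subseteq> V t) \<and> disjoint_family_on D P \<and> (\<Union>t\<in>P. D t) = B"
  using assms
proof (induction P arbitrary: B)
  case empty
  then show ?case by (simp add: disjoint_family_on_def)
next
  case (insert t P)
  have "B - V t \<subseteq> (\<Union>t\<in>P. V t)" "B - V t \<in> sets M"
    using insert.prems by auto
  then have "\<exists>D. (\<forall>s\<in>P. D s \<in> sets M \<and> D s \<subseteq> V s) \<and> disjoint_family_on D P \<and>
      (\<Union>s\<in>P. D s) = B - V t"
    using insert.IH[of "B - V t"] insert.prems(1) by auto
  then obtain D where D: "\<And>s. s \<in> P \<Longrightarrow> D s \<in> sets M" "\<And>s. s \<in> P \<Longrightarrow> D s \<subseteq> V s"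
      "disjoint_family_on D P" "(\<Union>s\<in>P. D s) = B - V t"
    by blast
  let ?D = "D(t := B \<inter> V t)"
  have same: "?D s = D s" if "s \<in> P" for s using that insert.hyps(2) by auto
  have "disjoint_family_on ?D (insert t P)"
  proof (unfold disjoint_family_on_def, intro ballI impI)
    fix r s assume rs: "r \<in> insert t P" "s \<in> insert t P" "r \<noteq> s"
    have *: "D s \<inter> (B \<inter> V t) = {}" if "s \<in> P" for s using that D(4) by auto
    show "?D r \<inter> ?D s = {}"
      using rs * disjoint_family_onD[OF D(3)] by (cases "r = t"; cases "s = t") auto
  qed
  moreover have "(\<Union>s\<in>insert t P. ?D s) = B"
  proof -
    have "(\<Union>s\<in>P. ?D s) = (\<Union>s\<in>P. D s)" by (rule SUP_cong[OF refl same])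
    then have "(\<Union>s\<in>insert t P. ?D s) = (B \<inter> V t) \<union> (B - V t)"
      unfolding UN_insert D(4) fun_upd_same by simp
    then show ?thesis by blast
  qed
  moreover have "\<forall>s\<in>insert t P. ?D s \<in> sets M \<and> ?D s \<subseteq> V s"
    using D(1,2) same insert.prems by auto
  ultimately show ?case by blast
qed

lemma has_KH_integral_iff:
  fixes \<mu> :: "'t::metric_space set \<Rightarrow>
      'r::{super_dedekind_complete_riesz_space, weakly_sigma_distributive_riesz_space,
           dedekind_complete_algebra}"
  shows "has_KH_integral \<mu> f A I \<longleftrightarrow>
    order_approx (\<lambda>r. \<exists>\<gamma>. gage \<gamma> \<and>
      (\<forall>q S \<tau>. partition_of \<mu> A q S \<tau> \<and> gamma_fine \<gamma> q S \<tau> \<longrightarrow>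
        \<bar>(\<Sum>i\<in>{1..q}. f (\<tau> i) * \<mu> (S i)) - I\<bar> \<le> r))"
  unfolding has_KH_integral_def
  by (rule D_sequence_iff_order_approx) (blast intro: order_trans)

lemma in_star_integral_iff:
  fixes \<mu> :: "'t::metric_space set \<Rightarrow>
      'r::{super_dedekind_complete_riesz_space, weakly_sigma_distributive_riesz_space,
           dedekind_complete_algebra}"
  shows "z \<in> star_integral \<mu> F A \<longleftrightarrow>
    order_approx (\<lambda>r. \<exists>\<gamma>. gage \<gamma> \<and>
      (\<forall>q S \<tau>. partition_of \<mu> A q S \<tau> \<and> gamma_fine \<gamma> q S \<tau> \<longrightarrow>
        (\<exists>c\<in>cl_sum q (\<lambda>i. set_times_elt (F (\<tau> i)) (\<mu> (S i))). \<bar>z - c\<bar> \<le> r)))"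
  unfolding star_integral_def mem_Collect_eq
  by (rule D_sequence_iff_order_approx) (blast intro: order_trans)

lemma gage_min: "gage \<gamma> \<Longrightarrow> gage \<gamma>' \<Longrightarrow> gage (\<lambda>t. min (\<gamma> t) (\<gamma>' t))"
  by (simp add: gage_def)

lemma gamma_fine_min:
  "gamma_fine (\<lambda>t. min (\<gamma> t) (\<gamma>' t)) q S \<tau> \<longleftrightarrow> gamma_fine \<gamma> q S \<tau> \<and> gamma_fine \<gamma>' q S \<tau>"
  by (auto simp: gamma_fine_def)

text \<open>
  Partitions are numbered by \<open>{1..q}\<close>; constructions of partitions are easier when the pieces are
  numbered by their distinct tags.  The last clause transfers all sums over the partition.
\<close>

lemma ex_partition_of_tagged_sets:
  fixes \<mu> :: "'t::metric_space set \<Rightarrow> 'r::dedekind_complete_riesz_space"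
  assumes \<mu>0: "\<mu> {} = 0" and P: "finite P"
    and D: "\<And>t. t \<in> P \<Longrightarrow> D t \<in> sets borel" "\<And>t. t \<in> P \<Longrightarrow> t \<in> D t"
      "\<And>t w. t \<in> P \<Longrightarrow> w \<in> D t \<Longrightarrow> dist w t < \<gamma> t"
      "disjoint_family_on D P" "(\<Union>t\<in>P. D t) = A"
  obtains q S \<tau> where "partition_of \<mu> A q S \<tau>" "gamma_fine \<gamma> q S \<tau>"
    "\<And>g :: 't \<Rightarrow> 't set \<Rightarrow> 'r. (\<Sum>i\<in>{1..q}. g (\<tau> i) (S i)) = (\<Sum>t\<in>P. g t (D t))"
proof -
  obtain \<tau> where \<tau>: "bij_betw \<tau> {1..card P} P"
    using ex_bij_betw_nat_finite_1[OF P] by blast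
  have mem: "\<tau> i \<in> P" if "i \<in> {1..card P}" for i
    using bij_betwE[OF \<tau>] that by blast
  have null: "\<mu> (D (\<tau> i) \<inter> D (\<tau> j)) = 0" if "i \<in> {1..card P}" "j \<in> {1..card P}" "i \<noteq> j" for i j
  proof -
    have "\<tau> i \<noteq> \<tau> j" using bij_betw_imp_inj_on[OF \<tau>] that by (auto dest: inj_onD)
    then show ?thesis using disjoint_family_onD[OF D(4) mem mem] that \<mu>0 by simp
  qed
  show thesis
  proof
    have "(\<Union>i\<in>{1..card P}. D (\<tau> i)) = (\<Union>t\<in>\<tau> ` {1..card P}. D t)" by simp
    also have "\<dots> = A" unfolding bij_betw_imp_surj_on[OF \<tau>] by (rule D(5))
    finally show "partition_of \<mu> A (card P) (\<lambda>i. D (\<tau> i)) \<tau>"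
      unfolding partition_of_def using mem D(1,2) null by blast
    show "gamma_fine \<gamma> (card P) (\<lambda>i. D (\<tau> i)) \<tau>"
      unfolding gamma_fine_def using mem D(3) by blast
    show "(\<Sum>i\<in>{1..card P}. g (\<tau> i) (D (\<tau> i))) = (\<Sum>t\<in>P. g t (D t))"
      for g :: "'t \<Rightarrow> 't set \<Rightarrow> 'r"
      by (rule sum.reindex_bij_betw[OF \<tau>])
  qed
qed

section \<open>Integrals of simple functions\<close>

context regular_additive
begin

lemma simple_int_const_on:
  assumes "\<And>w. w \<in> S \<Longrightarrow> f w = x" and f: "simple_function borel f"
  shows "simple_int \<mu> f S = x * \<mu> S"
proof (cases "S = {}")
  case False
  then have x: "x \<in> range f" using assms(1) by blast
  have "S \<inter> f -` {v} = (if v = x then S else {})" for v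
    using assms(1) by auto
  then have "simple_int \<mu> f S = (\<Sum>v\<in>range f. if v = x then x * \<mu> S else 0)"
    unfolding simple_int_def by (intro sum.cong) auto
  also have "\<dots> = x * \<mu> S"
    using x simple_function_borelD(1)[OF f] by simp
  finally show ?thesis .
qed (simp add: simple_int_def)

lemma simple_int_Union:
  assumes f: "simple_function borel f" and D: "finite I" "\<And>i. i \<in> I \<Longrightarrow> D i \<in> sets borel"
      "disjoint_family_on D I"
  shows "simple_int \<mu> f (\<Union>i\<in>I. D i) = (\<Sum>i\<in>I. simple_int \<mu> f (D i))"
proof -
  have "\<mu> ((\<Union>i\<in>I. D i) \<inter> f -` {v}) = (\<Sum>i\<in>I. \<mu> (D i \<inter> f -` {v}))" for v
  proof -
    have "disjoint_family_on (\<lambda>i. D i \<inter> f -` {v}) I"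
      using D(3) by (auto simp: disjoint_family_on_def)
    then have "\<mu> (\<Union>i\<in>I. D i \<inter> f -` {v}) = (\<Sum>i\<in>I. \<mu> (D i \<inter> f -` {v}))"
      using D simple_function_borelD(2)[OF f] by (intro measure_Union_disjoint) auto
    then show ?thesis by (simp add: Int_UN_distrib2)
  qed
  then show ?thesis
    unfolding simple_int_def prod_sum_right by (simp add: prod_sum_right sum.swap[of _ I])
qed

lemma abs_simple_int_le:
  assumes f: "simple_function borel f" and H: "\<And>t. \<bar>f t\<bar> \<le> H" and S: "S \<in> sets borel"
  shows "\<bar>simple_int \<mu> f S\<bar> \<le> H * \<mu> S"
proof -
  have meas: "S \<inter> f -` {v} \<in> sets borel" for v
    using S simple_function_borelD(2)[OF f] by auto
  have "\<bar>simple_int \<mu> f S\<bar> \<le> (\<Sum>v\<in>range f. \<bar>v * \<mu> (S \<inter> f -` {v})\<bar>)"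
    unfolding simple_int_def by (rule sum_abs)
  also have "\<dots> \<le> (\<Sum>v\<in>range f. H * \<mu> (S \<inter> f -` {v}))"
    by (rule sum_mono) (auto intro!: abs_prod_le H nonneg meas)
  also have "\<dots> = H * \<mu> (\<Union>v\<in>range f. S \<inter> f -` {v})"
    unfolding prod_sum_right[symmetric]
    by (subst measure_Union_disjoint)
      (auto intro!: meas simple_function_borelD(1)[OF f] simp: disjoint_family_on_def)
  also have "(\<Union>v\<in>range f. S \<inter> f -` {v}) = S" by auto
  finally show ?thesis .
qed

text \<open>
  On the part of \<open>D i\<close> outside \<open>W\<close> the contributions to the sum and to the integral coincide.  On
  \<open>D i \<inter> W\<close> each is at most \<open>H * \<mu> (D i \<inter> W)\<close>, and these pieces are disjoint.
\<close>

lemma abs_riemann_sum_diff_le: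
  assumes f: "simple_function borel f" and H: "\<And>t. \<bar>f t\<bar> \<le> H"
    and D: "finite I" "\<And>i. i \<in> I \<Longrightarrow> D i \<in> sets borel" "disjoint_family_on D I"
    and W: "W \<in> sets borel"
    and x: "\<And>i. i \<in> I \<Longrightarrow> \<bar>x i\<bar> \<le> H" "\<And>i w. i \<in> I \<Longrightarrow> w \<in> D i \<Longrightarrow> w \<notin> W \<Longrightarrow> f w = x i"
  shows "\<bar>(\<Sum>i\<in>I. x i * \<mu> (D i)) - simple_int \<mu> f (\<Union>i\<in>I. D i)\<bar> \<le> (H + H) * \<mu> W"
proof -
  have meas: "D i \<inter> W \<in> sets borel" "D i - W \<in> sets borel" if "i \<in> I" for i
    using D(2)[OF that] W by auto
  have piece: "x i * \<mu> (D i) - simple_int \<mu> f (D i) = x i * \<mu> (D i \<inter> W) - simple_int \<mu> f (D i \<inter> W)"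
    if i: "i \<in> I" for i
  proof -
    have "simple_int \<mu> f (\<Union>b\<in>{True, False}. if b then D i \<inter> W else D i - W)
        = (\<Sum>b\<in>{True, False}. simple_int \<mu> f (if b then D i \<inter> W else D i - W))"
      using meas[OF i] by (intro simple_int_Union[OF f]) (auto simp: disjoint_family_on_def)
    moreover have "(\<Union>b\<in>{True, False}. if b then D i \<inter> W else D i - W) = D i" by auto
    moreover have "simple_int \<mu> f (D i - W) = x i * \<mu> (D i - W)"
      by (rule simple_int_const_on[OF _ f]) (use x(2)[OF i] in auto)
    moreover have "\<mu> (D i) = \<mu> (D i \<inter> W) + \<mu> (D i - W)"
      by (rule measure_split[OF D(2)[OF i] W])
    ultimately show ?thesis by (simp add: prod_add_right)
  qed
  have "(\<Sum>i\<in>I. x i * \<mu> (D i)) - simple_int \<mu> f (\<Union>i\<in>I. D i)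
      = (\<Sum>i\<in>I. x i * \<mu> (D i \<inter> W) - simple_int \<mu> f (D i \<inter> W))"
    by (simp only: simple_int_Union[OF f D] sum_subtractf[symmetric] piece cong: sum.cong)
  also have "\<bar>\<dots>\<bar> \<le> (\<Sum>i\<in>I. \<bar>x i * \<mu> (D i \<inter> W) - simple_int \<mu> f (D i \<inter> W)\<bar>)"
    by (rule sum_abs)
  also have "\<dots> \<le> (\<Sum>i\<in>I. (H + H) * \<mu> (D i \<inter> W))"
  proof (rule sum_mono)
    fix i assume i: "i \<in> I"
    have "\<bar>x i * \<mu> (D i \<inter> W) - simple_int \<mu> f (D i \<inter> W)\<bar>
        \<le> \<bar>x i * \<mu> (D i \<inter> W)\<bar> + \<bar>simple_int \<mu> f (D i \<inter> W)\<bar>"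
      by (rule abs_triangle_ineq4)
    also have "\<dots> \<le> H * \<mu> (D i \<inter> W) + H * \<mu> (D i \<inter> W)"
      by (intro add_mono abs_prod_le abs_simple_int_le f H x(1)[OF i] nonneg meas(1)[OF i])
    finally show "\<bar>x i * \<mu> (D i \<inter> W) - simple_int \<mu> f (D i \<inter> W)\<bar> \<le> (H + H) * \<mu> (D i \<inter> W)"
      by (simp add: prod_add_left)
  qed
  also have "\<dots> = (H + H) * \<mu> (\<Union>i\<in>I. D i \<inter> W)"
  proof -
    have "disjoint_family_on (\<lambda>i. D i \<inter> W) I"
      using D(3) by (auto simp: disjoint_family_on_def)
    then show ?thesis
      unfolding prod_sum_right[symmetric] using D(1) meas(1) by (subst measure_Union_disjoint) auto
  qed
  also have "\<dots> \<le> (H + H) * \<mu> W"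
  proof (rule prod_mono_right)
    show "\<mu> (\<Union>i\<in>I. D i \<inter> W) \<le> \<mu> W"
      using D(1) meas(1) W by (intro measure_mono sets.finite_UN) auto
    have "0 \<le> H" using order_trans[OF abs_ge_zero H] .
    then show "0 \<le> H + H" by simp
  qed
  finally show ?thesis .
qed

text \<open>
  The pieces of a partition overlap in null sets only, so the overlaps can be removed without
  changing any value of \<open>\<mu>\<close>, though a tag may thereby leave its piece.
\<close>

lemma partition_of_disjoint_refinement:
  assumes "partition_of \<mu> A q S \<tau>"
  obtains D where "\<And>i. i \<in> {1..q} \<Longrightarrow> D i \<in> sets borel" "\<And>i. i \<in> {1..q} \<Longrightarrow> D i \<subseteq> S i"
    "\<And>i. i \<in> {1..q} \<Longrightarrow> \<mu> (D i) = \<mu> (S i)"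
    "disjoint_family_on D {1..q}" "(\<Union>i\<in>{1..q}. D i) = A"
proof -
  have S: "S i \<in> sets borel" if "i \<in> {1..q}" for i
    using assms that unfolding partition_of_def by blast
  have null: "\<mu> (S i \<inter> S j) = 0" if "i \<in> {1..q}" "j \<in> {1..q}" "i \<noteq> j" for i j
    using assms that unfolding partition_of_def by blast
  have A: "(\<Union>i\<in>{1..q}. S i) = A"
    using assms unfolding partition_of_def by blast
  define D where "D = (\<lambda>i. S i - (\<Union>j\<in>{1..<i}. S j))"
  show thesis
  proof
    show meas: "D i \<in> sets borel" if "i \<in> {1..q}" for i
      unfolding D_def using that by (intro sets.Diff sets.finite_UN S) auto
    show "D i \<subseteq> S i" for i unfolding D_def by blast
    show "\<mu> (D i) = \<mu> (S i)" if i: "i \<in> {1..q}" for i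
    proof -
      have measU: "(\<Union>j\<in>{1..<i}. S j) \<in> sets borel"
        using i by (intro sets.finite_UN S) auto
      have measI: "S i \<inter> S j \<in> sets borel" if "j \<in> {1..<i}" for j
        using i that by (intro sets.Int S) auto
      have "\<mu> (S i \<inter> (\<Union>j\<in>{1..<i}. S j)) = \<mu> (\<Union>j\<in>{1..<i}. S i \<inter> S j)"
        by (simp only: Int_UN_distrib)
      also have "\<dots> \<le> (\<Sum>j\<in>{1..<i}. \<mu> (S i \<inter> S j))"
        by (rule measure_Union_le) (use measI in auto)
      also have "\<dots> = 0"
        using i by (intro sum.neutral) (auto intro!: null)
      finally have "\<mu> (S i \<inter> (\<Union>j\<in>{1..<i}. S j)) = 0"
        using nonneg[OF sets.Int[OF S[OF i] measU]] by (rule antisym)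
      then show ?thesis
        using measure_split[OF S[OF i] measU] unfolding D_def by simp
    qed
    show "disjoint_family_on D {1..q}"
    proof (unfold disjoint_family_on_def, intro ballI impI)
      fix i j assume ij: "i \<in> {1..q}" "j \<in> {1..q}" "i \<noteq> j"
      have *: "D i \<inter> D j = {}" if "i \<in> {1..q}" "i < j" for i j
        using that unfolding D_def by auto
      show "D i \<inter> D j = {}"
        using *[OF ij(1), of j] *[OF ij(2), of i] ij(3) by (cases i j rule: linorder_cases) blast+
    qed
    show "(\<Union>i\<in>{1..q}. D i) = A"
    proof
      show "(\<Union>i\<in>{1..q}. D i) \<subseteq> A" using A unfolding D_def by blast
      show "A \<subseteq> (\<Union>i\<in>{1..q}. D i)"
      proof
        fix w assume "w \<in> A"
        then have "\<exists>i. i \<in> {1..q} \<and> w \<in> S i" using A by blast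
        then obtain i where i: "i \<in> {1..q} \<and> w \<in> S i"
            "\<And>j. j < i \<Longrightarrow> \<not> (j \<in> {1..q} \<and> w \<in> S j)"
          using exists_least_iff[of "\<lambda>i. i \<in> {1..q} \<and> w \<in> S i"] by blast
        then have "w \<in> D i" unfolding D_def by auto
        then show "w \<in> (\<Union>i\<in>{1..q}. D i)" using i(1) by blast
      qed
    qed
  qed
qed


text \<open>
  A fine partition for the gage of \<open>lusin_gage\<close> sees \<open>f\<close> as constant on each piece, up to \<open>W\<close>.
\<close>

lemma has_KH_integral_simple:
  assumes f: "simple_function borel f"
  shows "has_KH_integral \<mu> f A (simple_int \<mu> f A)"
proof -
  obtain H where H: "0 \<le> H" "\<And>t. \<bar>f t\<bar> \<le> H"
    using simple_function_bounded[OF f] by blast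
  have "0 \<le> H + H" using H(1) by simp
  with lusin_gage[OF f] show ?thesis
    unfolding has_KH_integral_iff
  proof (rule order_approx_prod)
    fix r assume "\<exists>\<gamma> W. gage \<gamma> \<and> W \<in> sets borel \<and> \<mu> W \<le> r \<and>
        (\<forall>t w. dist w t < \<gamma> t \<longrightarrow> f w \<noteq> f t \<longrightarrow> w \<in> W)"
    then obtain \<gamma> W where \<gamma>: "gage \<gamma>" and W: "W \<in> sets borel" "\<mu> W \<le> r"
        "\<And>t w. dist w t < \<gamma> t \<Longrightarrow> f w \<noteq> f t \<Longrightarrow> w \<in> W" by blast
    have "\<bar>(\<Sum>i\<in>{1..q}. f (\<tau> i) * \<mu> (S i)) - simple_int \<mu> f A\<bar> \<le> (H + H) * r"
      if part: "partition_of \<mu> A q S \<tau>" and fine: "gamma_fine \<gamma> q S \<tau>" for q S \<tau>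
    proof -
      obtain D where D: "\<And>i. i \<in> {1..q} \<Longrightarrow> D i \<in> sets borel" "\<And>i. i \<in> {1..q} \<Longrightarrow> D i \<subseteq> S i"
          "\<And>i. i \<in> {1..q} \<Longrightarrow> \<mu> (D i) = \<mu> (S i)"
          "disjoint_family_on D {1..q}" "(\<Union>i\<in>{1..q}. D i) = A"
        using partition_of_disjoint_refinement[OF part] by blast
      have "f w = f (\<tau> i)" if "i \<in> {1..q}" "w \<in> D i" "w \<notin> W" for i w
        using fine D(2) that W(3) unfolding gamma_fine_def by blast
      then have "\<bar>(\<Sum>i\<in>{1..q}. f (\<tau> i) * \<mu> (D i)) - simple_int \<mu> f (\<Union>i\<in>{1..q}. D i)\<bar>
          \<le> (H + H) * \<mu> W"
        by (intro abs_riemann_sum_diff_le f H(2) D(1,4) W(1)) auto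
      also have "\<dots> \<le> (H + H) * r"
        using W(2) \<open>0 \<le> H + H\<close> by (rule prod_mono_right)
      finally show ?thesis unfolding D(5) by (simp only: D(3) cong: sum.cong)
    qed
    then show "\<exists>\<gamma>. gage \<gamma> \<and> (\<forall>q S \<tau>. partition_of \<mu> A q S \<tau> \<and> gamma_fine \<gamma> q S \<tau> \<longrightarrow>
        \<bar>(\<Sum>i\<in>{1..q}. f (\<tau> i) * \<mu> (S i)) - simple_int \<mu> f A\<bar> \<le> (H + H) * r)"
      using \<gamma> by blast
  qed
qed

text \<open>
  Every Riemann sum of \<open>F\<close> is almost the integral of a simple selection.  The selection takes the
  value \<open>x i\<close> on the points of the \<open>i\<close>-th piece at which \<open>F\<close> agrees with its value at the tag, and a
  fixed element of \<open>F\<close> elsewhere.  The values \<open>x i\<close> at different tags in one level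
  set of \<open>F\<close> cannot be averaged into a single one, since the weights \<open>\<mu> (S i)\<close> are elements of the
  algebra and not scalars; therefore selections vary on the level sets.
\<close>

lemma simple_selections_riemann_sum:
  assumes F: "simple_function borel F" and ne: "\<And>t. F t \<noteq> {}"
    and H: "\<And>t x. x \<in> F t \<Longrightarrow> \<bar>x\<bar> \<le> H"
  shows "order_approx (\<lambda>r. \<exists>\<gamma>. gage \<gamma> \<and>
    (\<forall>q S \<tau> x. partition_of \<mu> A q S \<tau> \<and> gamma_fine \<gamma> q S \<tau> \<and> (\<forall>i\<in>{1..q}. x i \<in> F (\<tau> i)) \<longrightarrow>
      (\<exists>f\<in>simple_selections F. \<bar>(\<Sum>i\<in>{1..q}. x i * \<mu> (S i)) - simple_int \<mu> f A\<bar> \<le> r)))"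
proof -
  have "0 \<le> H"
    using ne H order_trans[OF abs_ge_zero] by blast
  then have H2: "0 \<le> H + H" by simp
  with lusin_gage[OF F] show ?thesis
  proof (rule order_approx_prod)
    fix r assume "\<exists>\<gamma> W. gage \<gamma> \<and> W \<in> sets borel \<and> \<mu> W \<le> r \<and>
        (\<forall>t w. dist w t < \<gamma> t \<longrightarrow> F w \<noteq> F t \<longrightarrow> w \<in> W)"
    then obtain \<gamma> W where \<gamma>: "gage \<gamma>" and W: "W \<in> sets borel" "\<mu> W \<le> r"
        "\<And>t w. dist w t < \<gamma> t \<Longrightarrow> F w \<noteq> F t \<Longrightarrow> w \<in> W" by blast
    have "\<exists>f\<in>simple_selections F. \<bar>(\<Sum>i\<in>{1..q}. x i * \<mu> (S i)) - simple_int \<mu> f A\<bar> \<le> (H + H) * r"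
      if part: "partition_of \<mu> A q S \<tau>" and fine: "gamma_fine \<gamma> q S \<tau>"
        and x: "\<forall>i\<in>{1..q}. x i \<in> F (\<tau> i)" for q S \<tau> x
    proof -
      obtain D where D: "\<And>i. i \<in> {1..q} \<Longrightarrow> D i \<in> sets borel" "\<And>i. i \<in> {1..q} \<Longrightarrow> D i \<subseteq> S i"
          "\<And>i. i \<in> {1..q} \<Longrightarrow> \<mu> (D i) = \<mu> (S i)"
          "disjoint_family_on D {1..q}" "(\<Union>i\<in>{1..q}. D i) = A"
        using partition_of_disjoint_refinement[OF part] by blast
      obtain \<iota> :: "'t \<Rightarrow> nat" where \<iota>: "simple_function borel \<iota>"
          "\<And>i w. i \<in> {1..q} \<Longrightarrow> w \<in> D i \<Longrightarrow> \<iota> w = i"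
        using ex_simple_index[of "{1..q}" D] D(1,4) by blast
      define f where "f = (\<lambda>w. if \<iota> w \<in> {1..q} \<and> F w = F (\<tau> (\<iota> w)) then x (\<iota> w) else (SOME y. y \<in> F w))"
      have "simple_function borel f"
        unfolding f_def
        by (rule simple_function_compose2[OF \<iota>(1) F, where
              h = "\<lambda>i V. if i \<in> {1..q} \<and> V = F (\<tau> i) then x i else (SOME y. y \<in> V)"])
      moreover have sel: "f t \<in> F t" for t
        unfolding f_def using x ne[of t] by (auto simp: some_in_eq)
      ultimately have f: "f \<in> simple_selections F" "simple_function borel f"
        unfolding simple_selections_def by auto
      have fx: "f w = x i" if "i \<in> {1..q}" "w \<in> D i" "w \<notin> W" for i w
      proof -
        have "F w = F (\<tau> i)"
          using fine D(2) that W(3) unfolding gamma_fine_def by blast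
        then show ?thesis using \<iota>(2)[OF that(1,2)] that(1) unfolding f_def by simp
      qed
      have "\<bar>(\<Sum>i\<in>{1..q}. x i * \<mu> (D i)) - simple_int \<mu> f (\<Union>i\<in>{1..q}. D i)\<bar> \<le> (H + H) * \<mu> W"
        by (intro abs_riemann_sum_diff_le f(2) H[OF sel] D(1,4) W(1) fx H[OF bspec[OF x]] finite_atLeastAtMost)
      also have "\<dots> \<le> (H + H) * r"
        using W(2) H2 by (rule prod_mono_right)
      finally have "\<bar>(\<Sum>i\<in>{1..q}. x i * \<mu> (S i)) - simple_int \<mu> f A\<bar> \<le> (H + H) * r"
        unfolding D(5) by (simp only: D(3) cong: sum.cong)
      then show ?thesis using f(1) by blast
    qed
    then show "\<exists>\<gamma>. gage \<gamma> \<and>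
        (\<forall>q S \<tau> x. partition_of \<mu> A q S \<tau> \<and> gamma_fine \<gamma> q S \<tau> \<and> (\<forall>i\<in>{1..q}. x i \<in> F (\<tau> i)) \<longrightarrow>
        (\<exists>f\<in>simple_selections F. \<bar>(\<Sum>i\<in>{1..q}. x i * \<mu> (S i)) - simple_int \<mu> f A\<bar> \<le> (H + H) * r))"
      using \<gamma> by (intro exI[of _ \<gamma>]) auto
  qed
qed

section \<open>Fine partitions of compact sets\<close>

text \<open>
  A gage may force tags into a null set \<open>N\<close>, on which an integrand \<open>h\<close> can be unbounded.  To keep their
  contribution small, the tags in \<open>N\<close> are confined to a finite set \<open>P\<close> fixed in advance, the centres
  of a finite cover of \<open>A\<close>.  The points outside \<open>N\<close> with gage above \<open>1 / (m + 1)\<close> form a set \<open>T m\<close>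
  that need not be measurable, but balls of this radius around finitely many of its points cover its
  closure \<open>G m\<close>.  Tags in \<open>P\<close> then have to deal only with \<open>A - G m\<close>, whose measure tends to \<open>0\<close>,
  while \<open>\<Sum>t\<in>P. h t\<close> stays fixed.
\<close>

lemma fine_partition_few_null_tags:
  fixes h :: "'t \<Rightarrow> 'r"
  assumes A: "compact A" and \<gamma>: "gage \<gamma>" and N: "N \<in> sets borel" "\<mu> N = 0"
    and h: "\<And>t. 0 \<le> h t"
  shows "order_approx (\<lambda>s. \<exists>q S \<tau>. partition_of \<mu> A q S \<tau> \<and> gamma_fine \<gamma> q S \<tau> \<and>
    (\<Sum>i\<in>{1..q}. if \<tau> i \<in> N then h (\<tau> i) * \<mu> (S i) else 0) \<le> s)"
proof -
  have \<gamma>0: "0 < \<gamma> t" for t using \<gamma> unfolding gage_def by blast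
  have measA: "A \<in> sets borel" by (rule borel_compact[OF A])
  have "A \<subseteq> (\<Union>t\<in>A. ball t (\<gamma> t))" using \<gamma>0 by auto
  then obtain P where P: "P \<subseteq> A" "finite P" "A \<subseteq> (\<Union>t\<in>P. ball t (\<gamma> t))"
    using compactE_image[OF A, of A "\<lambda>t. ball t (\<gamma> t)"] by auto
  define T where "T = (\<lambda>m::nat. {t \<in> A - N. inverse (Suc m) < \<gamma> t})"
  define G where "G = (\<lambda>m. closure (T m))"
  have closedG: "closed (G m)" for m unfolding G_def by simp
  then have measG: "G m \<in> sets borel" for m by (rule borel_closed)
  have monoT: "T m \<subseteq> T n" if "m \<le> n" for m n
  proof -
    have "inverse (real (Suc n)) \<le> inverse (real (Suc m))" using that by simp
    from le_less_trans[OF this] show ?thesis unfolding T_def by blast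
  qed
  have small: "order_null (\<lambda>m. \<mu> (A - G m))"
  proof (rule order_null_measure_antimono[OF _ _ N])
    show "A - G m \<in> sets borel" for m using measA measG by auto
    show "decseq (\<lambda>m. A - G m)"
      unfolding decseq_def G_def using closure_mono[OF monoT] by blast
    show "(\<Inter>m. A - G m) \<subseteq> N"
    proof
      fix t assume t: "t \<in> (\<Inter>m. A - G m)"
      obtain m where "inverse (Suc m) < \<gamma> t" using reals_Archimedean[OF \<gamma>0] by blast
      then have "t \<in> G m" if "t \<notin> N"
        using t that closure_subset[of "T m"] unfolding G_def T_def by auto
      then show "t \<in> N" using t by blast
    qed
  qed
  define H where "H = (\<Sum>t\<in>P. h t)"
  have H: "0 \<le> H" unfolding H_def by (intro sum_nonneg h)
  have "order_approx (\<lambda>r. \<exists>m. \<mu> (A - G m) = r)"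
    by (rule order_approxI[OF small]) blast
  then show ?thesis
  proof (rule order_approx_prod[OF _ H])
    fix r assume "\<exists>m. \<mu> (A - G m) = r"
    then obtain m where r: "\<mu> (A - G m) = r" by blast
    let ?e = "inverse (real (Suc m))"
    have "G m \<subseteq> (\<Union>t\<in>T m. ball t ?e)"
      unfolding G_def by (auto simp: closure_approachable)
    moreover have "compact (G m)"
      using compact_Int_closed[OF compact_space closedG] by simp
    ultimately obtain P' where P': "P' \<subseteq> T m" "finite P'" "G m \<subseteq> (\<Union>t\<in>P'. ball t ?e)"
      using compactE_image[of "G m" "T m" "\<lambda>t. ball t ?e"] by auto
    define Q where "Q = P \<union> P'"
    have Q: "finite Q" "Q \<subseteq> A" "Q \<in> sets borel"
      unfolding Q_def using P P' by (auto simp: T_def intro!: borel_closed finite_imp_closed)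
    have "\<exists>D. (\<forall>t\<in>P. D t \<in> sets borel \<and> D t \<subseteq> ball t (\<gamma> t)) \<and> disjoint_family_on D P \<and>
        (\<Union>t\<in>P. D t) = (A - G m) - Q"
      by (rule ex_disjoint_pieces[OF P(2)]) (use P(3) measA measG Q(3) in auto)
    then obtain D where D: "\<And>t. t \<in> P \<Longrightarrow> D t \<in> sets borel" "\<And>t. t \<in> P \<Longrightarrow> D t \<subseteq> ball t (\<gamma> t)"
        "disjoint_family_on D P" "(\<Union>t\<in>P. D t) = (A - G m) - Q"
      by blast
    have "\<exists>D. (\<forall>t\<in>P'. D t \<in> sets borel \<and> D t \<subseteq> ball t ?e) \<and> disjoint_family_on D P' \<and>
        (\<Union>t\<in>P'. D t) = (A \<inter> G m) - Q"
      by (rule ex_disjoint_pieces[OF P'(2)]) (use P'(3) measA measG Q(3) in auto)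
    then obtain D' where D': "\<And>t. t \<in> P' \<Longrightarrow> D' t \<in> sets borel" "\<And>t. t \<in> P' \<Longrightarrow> D' t \<subseteq> ball t ?e"
        "disjoint_family_on D' P'" "(\<Union>t\<in>P'. D' t) = (A \<inter> G m) - Q"
      by blast
    \<comment> \<open>A tag has to belong to its own piece, so the tags are set apart first and then added.\<close>
    define B where "B = (\<lambda>t. insert t ((if t \<in> P then D t else {}) \<union> (if t \<in> P' then D' t else {})))"
    have B: "B t \<in> sets borel" for t
      unfolding B_def using D(1) D'(1) by auto
    have tB: "t \<in> B t" for t unfolding B_def by simp
    have fineB: "dist w t < \<gamma> t" if "t \<in> Q" "w \<in> B t" for t w
    proof -
      have "?e < \<gamma> t" if "t \<in> P'" using P'(1) that unfolding T_def by auto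
      then show ?thesis
        using that(2) \<gamma>0[of t] D(2)[of t] D'(2)[of t] unfolding B_def
        by (auto simp: dist_commute split: if_splits dest!: subsetD)
    qed
    have notQ: "w \<notin> Q" "w \<in> A" if "t \<in> P \<and> w \<in> D t \<or> t \<in> P' \<and> w \<in> D' t" for t w
      using that D(4) D'(4) by blast+
    have B_cases: "w = t \<or> (t \<in> P \<and> w \<in> D t \<or> t \<in> P' \<and> w \<in> D' t)" if "w \<in> B t" for t w
      using that unfolding B_def by (auto split: if_splits)
    have disjB: "disjoint_family_on B Q"
    proof (unfold disjoint_family_on_def, intro ballI impI)
      fix s t assume st: "s \<in> Q" "t \<in> Q" "s \<noteq> t"
      have "False" if w: "w \<in> B s" "w \<in> B t" for w
      proof (cases "w \<in> Q")
        case True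
        then show False using B_cases[OF w(1)] B_cases[OF w(2)] st(3) notQ(1) by blast
      next
        case False
        then have w': "s \<in> P \<and> w \<in> D s \<or> s \<in> P' \<and> w \<in> D' s" "t \<in> P \<and> w \<in> D t \<or> t \<in> P' \<and> w \<in> D' t"
          using B_cases[OF w(1)] B_cases[OF w(2)] st(1,2) by blast+
        have "w \<notin> G m" if "u \<in> P" "w \<in> D u" for u using that D(4) by blast
        moreover have "w \<in> G m" if "u \<in> P'" "w \<in> D' u" for u using that D'(4) by blast
        ultimately show False
          using w' disjoint_family_onD[OF D(3) _ _ st(3)] disjoint_family_onD[OF D'(3) _ _ st(3)]
          by blast
      qed
      then show "B s \<inter> B t = {}" by blast
    qed
    have UnB: "(\<Union>t\<in>Q. B t) = A"
    proof
      show "(\<Union>t\<in>Q. B t) \<subseteq> A"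
        using Q(2) notQ(2) B_cases by blast
      show "A \<subseteq> (\<Union>t\<in>Q. B t)"
      proof
        fix w assume w: "w \<in> A"
        show "w \<in> (\<Union>t\<in>Q. B t)"
        proof (cases "w \<in> Q")
          case False
          then have "w \<in> (\<Union>t\<in>P. D t) \<or> w \<in> (\<Union>t\<in>P'. D' t)" using w D(4) D'(4) by blast
          then show ?thesis unfolding B_def Q_def by auto
        qed (use tB in blast)
      qed
    qed
    obtain q S \<tau> where part: "partition_of \<mu> A q S \<tau>" "gamma_fine \<gamma> q S \<tau>"
      and sum: "\<And>g :: 't \<Rightarrow> 't set \<Rightarrow> 'r. (\<Sum>i\<in>{1..q}. g (\<tau> i) (S i)) = (\<Sum>t\<in>Q. g t (B t))"
      using ex_partition_of_tagged_sets[where \<mu> = \<mu> and P = Q and D = B and \<gamma> = \<gamma> and A = A,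
          OF measure_empty Q(1) B tB fineB disjB UnB] by blast
    have bound: "(if t \<in> N then h t * \<mu> (B t) else 0) \<le> (if t \<in> P then h t * r else 0)"
      if t: "t \<in> Q" for t
    proof (cases "t \<in> N")
      case True
      then have "t \<notin> P'" using P'(1) unfolding T_def by auto
      then have tP: "t \<in> P" and Bt: "B t = {t} \<union> D t" using t unfolding Q_def B_def by auto
      have "\<mu> (B t) \<le> \<mu> {t} + \<mu> (D t)"
        unfolding Bt using D(1)[OF tP] by (intro measure_Un_le) auto
      also have "\<mu> {t} = 0"
        using True by (intro measure_null_subset[OF _ N(1) _ N(2)]) auto
      also have "\<mu> (D t) \<le> r"
        unfolding r[symmetric] using D(4) tP measA measG
        by (intro measure_mono D(1)[OF tP]) auto
      finally have "h t * \<mu> (B t) \<le> h t * r"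
        by (intro prod_mono_right h) simp
      then show ?thesis using True tP by simp
    next
      case False
      have "0 \<le> r" unfolding r[symmetric] using measA measG by (intro nonneg) auto
      then show ?thesis using False h by (auto intro: prod_nonneg)
    qed
    have "(\<Sum>i\<in>{1..q}. if \<tau> i \<in> N then h (\<tau> i) * \<mu> (S i) else 0)
        = (\<Sum>t\<in>Q. if t \<in> N then h t * \<mu> (B t) else 0)"
      by (rule sum[of "\<lambda>t S. if t \<in> N then h t * \<mu> S else 0"])
    also have "\<dots> \<le> (\<Sum>t\<in>Q. if t \<in> P then h t * r else 0)"
      by (rule sum_mono[OF bound])
    also have "\<dots> = (\<Sum>t\<in>P. h t * r)"
      unfolding Q_def using P(2) P'(2) by (intro sum.mono_neutral_cong_right) auto
    also have "\<dots> = H * r" unfolding H_def by (rule prod_sum_left[symmetric])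
    finally show "\<exists>q S \<tau>. partition_of \<mu> A q S \<tau> \<and> gamma_fine \<gamma> q S \<tau> \<and>
        (\<Sum>i\<in>{1..q}. if \<tau> i \<in> N then h (\<tau> i) * \<mu> (S i) else 0) \<le> H * r"
      using part by blast
  qed
qed

end

section \<open>Comparison of the two integrals\<close>

text \<open>
  A gage may shrink near a missing limit point \<open>x\<close>; finitely many pieces then stay away from \<open>x\<close>.
\<close>

lemma ex_gage_without_fine_partition:
  fixes A :: "'t::metric_space set" and \<mu> :: "'t set \<Rightarrow> 'r::dedekind_complete_riesz_space"
  assumes "\<not> closed A"
  obtains \<gamma> where "gage \<gamma>" "\<And>q S \<tau>. \<not> (partition_of \<mu> A q S \<tau> \<and> gamma_fine \<gamma> q S \<tau>)"
proof -
  obtain x where x: "x \<in> closure A" "x \<notin> A"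
    using assms closure_subset_eq[of A] by blast
  define \<gamma> where "\<gamma> = (\<lambda>t. if t = x then 1 else dist t x / 2)"
  show thesis
  proof (rule that)
    show "gage \<gamma>" unfolding gage_def \<gamma>_def by simp
    fix q S \<tau>
    show "\<not> (partition_of \<mu> A q S \<tau> \<and> gamma_fine \<gamma> q S \<tau>)"
    proof
      assume *: "partition_of \<mu> A q S \<tau> \<and> gamma_fine \<gamma> q S \<tau>"
      then have A: "(\<Union>i\<in>{1..q}. S i) = A" and tag: "\<And>i. i \<in> {1..q} \<Longrightarrow> \<tau> i \<in> S i"
        and fine: "\<And>i w. i \<in> {1..q} \<Longrightarrow> w \<in> S i \<Longrightarrow> dist w (\<tau> i) < \<gamma> (\<tau> i)"
        unfolding partition_of_def gamma_fine_def by blast+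
      have neq: "\<tau> i \<noteq> x" if "i \<in> {1..q}" for i
        using tag[OF that] that A x(2) by blast
      define e where "e = Min (insert 1 ((\<lambda>i. dist (\<tau> i) x / 2) ` {1..q}))"
      have "0 < e" unfolding e_def using neq by (subst Min_gr_iff) auto
      then obtain w where w: "w \<in> A" "dist w x < e"
        using x(1) unfolding closure_approachable by blast
      then obtain i where i: "i \<in> {1..q}" "w \<in> S i" using A by blast
      have "e \<le> dist (\<tau> i) x / 2" unfolding e_def using i(1) by (intro Min_le) auto
      moreover have "dist w (\<tau> i) < dist (\<tau> i) x / 2"
        using fine[OF i] neq[OF i(1)] unfolding \<gamma>_def by simp
      moreover have "dist (\<tau> i) x \<le> dist w (\<tau> i) + dist w x"
        by (rule dist_triangle3)
      ultimately show False using w(2) by simp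
    qed
  qed
qed

lemma mem_sum_set_times_elt_iff:
  fixes c :: "'r::dedekind_complete_algebra"
  shows "c \<in> (\<Sum>i\<in>{1..q::nat}. set_times_elt (V i) (m i)) \<longleftrightarrow>
    (\<exists>x. (\<forall>i\<in>{1..q}. x i \<in> V i) \<and> c = (\<Sum>i\<in>{1..q}. x i * m i))"
proof -
  have "c \<in> (\<Sum>i\<in>{1..q}. set_times_elt (V i) (m i)) \<longleftrightarrow>
      (\<exists>s. (\<forall>i\<in>{1..q}. s i \<in> set_times_elt (V i) (m i)) \<and> c = sum s {1..q})"
    by (subst set_sum_alt) auto
  also have "\<dots> \<longleftrightarrow> (\<exists>x. (\<forall>i\<in>{1..q}. x i \<in> V i) \<and> c = (\<Sum>i\<in>{1..q}. x i * m i))"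
  proof
    assume "\<exists>s. (\<forall>i\<in>{1..q}. s i \<in> set_times_elt (V i) (m i)) \<and> c = sum s {1..q}"
    then obtain s where s: "\<And>i. i \<in> {1..q} \<Longrightarrow> s i \<in> set_times_elt (V i) (m i)" "c = sum s {1..q}"
      by blast
    have "\<forall>i\<in>{1..q}. \<exists>x. x \<in> V i \<and> s i = x * m i"
      using s(1) unfolding set_times_elt_def by blast
    then obtain x where x: "\<And>i. i \<in> {1..q} \<Longrightarrow> x i \<in> V i" "\<And>i. i \<in> {1..q} \<Longrightarrow> s i = x i * m i"
      by (subst (asm) bchoice_iff) blast
    have "c = (\<Sum>i\<in>{1..q}. x i * m i)"
      unfolding s(2) by (rule sum.cong[OF refl x(2)])
    then show "\<exists>x. (\<forall>i\<in>{1..q}. x i \<in> V i) \<and> c = (\<Sum>i\<in>{1..q}. x i * m i)"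
      using x(1) by blast
  next
    assume "\<exists>x. (\<forall>i\<in>{1..q}. x i \<in> V i) \<and> c = (\<Sum>i\<in>{1..q}. x i * m i)"
    then obtain x where x: "\<forall>i\<in>{1..q}. x i \<in> V i" "c = (\<Sum>i\<in>{1..q}. x i * m i)" by blast
    then show "\<exists>s. (\<forall>i\<in>{1..q}. s i \<in> set_times_elt (V i) (m i)) \<and> c = sum s {1..q}"
      unfolding set_times_elt_def by (intro exI[of _ "\<lambda>i. x i * m i"]) blast
  qed
  finally show ?thesis .
qed

context regular_additive
begin

lemma simple_selections_subset_S1: "simple_selections F \<subseteq> S1 \<mu> F"
proof
  fix f assume f: "f \<in> simple_selections F"
  then have "has_KH_integral \<mu> f UNIV (simple_int \<mu> f UNIV)"
    unfolding simple_selections_def by (intro has_KH_integral_simple) simp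
  moreover have "ae \<mu> (\<lambda>t. f t \<in> F t)"
    unfolding ae_def using f by (intro bexI[of _ "{}"]) (auto simp: simple_selections_def)
  ultimately show "f \<in> S1 \<mu> F" unfolding S1_def by blast
qed

lemma simple_int_in_aumann_integral:
  assumes "f \<in> simple_selections F"
  shows "simple_int \<mu> f A \<in> aumann_integral \<mu> F A"
proof -
  have "has_KH_integral \<mu> f A (simple_int \<mu> f A)"
    using assms by (intro has_KH_integral_simple) (simp add: simple_selections_def)
  then show ?thesis
    unfolding aumann_integral_def using subsetD[OF simple_selections_subset_S1 assms] by blast
qed

lemma ex_simple_selection:
  assumes F: "simple_function borel F" and ne: "\<And>t. F t \<noteq> {}"
  shows "(\<lambda>t. SOME x. x \<in> F t) \<in> simple_selections F"
proof -
  have "simple_function borel (\<lambda>t. SOME x. x \<in> F t)"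
    by (rule simple_function_compose1[OF F])
  moreover have "(SOME x. x \<in> F t) \<in> F t" for t
    using ne[of t] by (simp only: some_in_eq) blast
  ultimately show ?thesis unfolding simple_selections_def by blast
qed

text \<open>
  Without fine partitions both integrals impose no condition.
\<close>

lemma integrals_eq_UNIV_if_not_closed:
  assumes "\<not> closed A" and f: "f \<in> S1 \<mu> F"
  shows "star_integral \<mu> F A = UNIV" "aumann_integral \<mu> F A = UNIV"
proof -
  obtain \<gamma> where "gage \<gamma>" "\<And>q S \<tau>. \<not> (partition_of \<mu> A q S \<tau> \<and> gamma_fine \<gamma> q S \<tau>)"
    using ex_gage_without_fine_partition[OF assms(1), of \<mu>] by blast
  then have vacuous: "\<exists>\<gamma>. gage \<gamma> \<and> (\<forall>q S \<tau>. partition_of \<mu> A q S \<tau> \<and> gamma_fine \<gamma> q S \<tau> \<longrightarrow> R q S \<tau>)"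
    for R by (intro exI[of _ \<gamma>]) blast
  have "z \<in> star_integral \<mu> F A" for z
    unfolding in_star_integral_iff by (rule order_approx_trivial) (rule vacuous)
  then show "star_integral \<mu> F A = UNIV" by blast
  have "has_KH_integral \<mu> f A I" for I
    unfolding has_KH_integral_iff by (rule order_approx_trivial) (rule vacuous)
  then show "aumann_integral \<mu> F A = UNIV"
    unfolding aumann_integral_def using f by blast
qed

lemma abs_simple_selection_int_le:
  assumes "x \<in> (\<lambda>f. simple_int \<mu> f A) ` simple_selections F"
    and H: "\<And>t x. x \<in> F t \<Longrightarrow> \<bar>x\<bar> \<le> H" and A: "A \<in> sets borel"
  shows "\<bar>x\<bar> \<le> H * \<mu> A"
proof -
  obtain f where f: "f \<in> simple_selections F" and x: "x = simple_int \<mu> f A"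
    using assms(1) by blast
  show ?thesis
    unfolding x by (rule abs_simple_int_le[OF _ _ A]) (use f H in \<open>auto simp: simple_selections_def\<close>)
qed

lemma abs_riemann_sum_le:
  assumes part: "partition_of \<mu> A q S \<tau>" and x: "\<And>i. i \<in> {1..q} \<Longrightarrow> \<bar>x i\<bar> \<le> H"
  shows "\<bar>\<Sum>i\<in>{1..q}. x i * \<mu> (S i)\<bar> \<le> H * \<mu> A"
proof -
  obtain D where D: "\<And>i. i \<in> {1..q} \<Longrightarrow> D i \<in> sets borel"
      "\<And>i. i \<in> {1..q} \<Longrightarrow> \<mu> (D i) = \<mu> (S i)"
      "disjoint_family_on D {1..q}" "(\<Union>i\<in>{1..q}. D i) = A"
    using partition_of_disjoint_refinement[OF part] by blast
  have "\<bar>\<Sum>i\<in>{1..q}. x i * \<mu> (S i)\<bar> \<le> (\<Sum>i\<in>{1..q}. \<bar>x i * \<mu> (S i)\<bar>)"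
    by (rule sum_abs)
  also have "\<dots> \<le> (\<Sum>i\<in>{1..q}. H * \<mu> (S i))"
    using part unfolding partition_of_def by (intro sum_mono abs_prod_le x nonneg) auto
  also have "\<dots> = H * (\<Sum>i\<in>{1..q}. \<mu> (D i))"
    by (simp only: prod_sum_right D(2) cong: sum.cong)
  also have "\<dots> = H * \<mu> A"
    unfolding D(4)[symmetric] by (subst measure_Union_disjoint) (use D(1,3) in auto)
  finally show ?thesis .
qed

text \<open>
  For compact \<open>A\<close> a fine partition exists, and it suffices to use a single one for each accuracy.
\<close>

lemma star_integral_subset_cl_simple_int:
  assumes F: "simple_function borel F" and ne: "\<And>t. F t \<noteq> {}"
    and H: "\<And>t x. x \<in> F t \<Longrightarrow> \<bar>x\<bar> \<le> H" and A: "compact A"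
  shows "star_integral \<mu> F A \<subseteq> cl ((\<lambda>f. simple_int \<mu> f A) ` simple_selections F)"
proof
  let ?X = "(\<lambda>f. simple_int \<mu> f A) ` simple_selections F"
  fix z assume "z \<in> star_integral \<mu> F A"
  show "z \<in> cl ?X"
  proof (rule in_cl_diagonal)
    show "\<bar>x\<bar> \<le> H * \<mu> A" if "x \<in> ?X" for x
      by (rule abs_simple_selection_int_le[OF that H borel_compact[OF A]])
    show "order_approx (\<lambda>r. order_approx (\<lambda>s. \<exists>x\<in>?X. \<bar>x - z\<bar> \<le> r + s))"
      using \<open>z \<in> star_integral \<mu> F A\<close>[unfolded in_star_integral_iff]
        simple_selections_riemann_sum[where F = F and H = H and A = A, OF F ne H]
    proof (rule order_approx_add)
      fix r1 r2
      let ?Y = "\<lambda>q S \<tau>. \<Sum>i\<in>{1..q}. set_times_elt (F (\<tau> i)) (\<mu> (S i))"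
      assume "\<exists>\<gamma>. gage \<gamma> \<and>
        (\<forall>q S \<tau>. partition_of \<mu> A q S \<tau> \<and> gamma_fine \<gamma> q S \<tau> \<longrightarrow>
          (\<exists>c\<in>cl_sum q (\<lambda>i. set_times_elt (F (\<tau> i)) (\<mu> (S i))). \<bar>z - c\<bar> \<le> r1))"
      then obtain \<gamma>1 where \<gamma>1: "gage \<gamma>1" "\<And>q S \<tau>. partition_of \<mu> A q S \<tau> \<Longrightarrow> gamma_fine \<gamma>1 q S \<tau> \<Longrightarrow>
          \<exists>c\<in>cl (?Y q S \<tau>). \<bar>z - c\<bar> \<le> r1"
        unfolding cl_sum_def by blast
      assume "\<exists>\<gamma>. gage \<gamma> \<and>
        (\<forall>q S \<tau> x. partition_of \<mu> A q S \<tau> \<and> gamma_fine \<gamma> q S \<tau> \<and> (\<forall>i\<in>{1..q}. x i \<in> F (\<tau> i)) \<longrightarrow>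
          (\<exists>f\<in>simple_selections F. \<bar>(\<Sum>i\<in>{1..q}. x i * \<mu> (S i)) - simple_int \<mu> f A\<bar> \<le> r2))"
      then obtain \<gamma>2 where \<gamma>2: "gage \<gamma>2" "\<And>q S \<tau> x. partition_of \<mu> A q S \<tau> \<Longrightarrow> gamma_fine \<gamma>2 q S \<tau> \<Longrightarrow>
          \<forall>i\<in>{1..q}. x i \<in> F (\<tau> i) \<Longrightarrow>
          \<exists>f\<in>simple_selections F. \<bar>(\<Sum>i\<in>{1..q}. x i * \<mu> (S i)) - simple_int \<mu> f A\<bar> \<le> r2"
        by blast
      obtain q S \<tau> where part: "partition_of \<mu> A q S \<tau>"
          and "gamma_fine (\<lambda>t. min (\<gamma>1 t) (\<gamma>2 t)) q S \<tau>"
        using fine_partition_few_null_tags[OF A gage_min[OF \<gamma>1(1) \<gamma>2(1)] sets.empty_sets measure_empty,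
            of "\<lambda>_. 0"] unfolding order_approx_def by blast
      then have fine: "gamma_fine \<gamma>1 q S \<tau>" "gamma_fine \<gamma>2 q S \<tau>" by (simp_all add: gamma_fine_min)
      obtain c where c: "c \<in> cl (?Y q S \<tau>)" "\<bar>z - c\<bar> \<le> r1" using \<gamma>1(2)[OF part fine(1)] by blast
      show "order_approx (\<lambda>s. \<exists>x\<in>?X. \<bar>x - z\<bar> \<le> r1 + r2 + s)"
        using c(1)[unfolded in_cl_iff]
      proof (rule order_approx_mono)
        fix s assume "\<exists>y\<in>?Y q S \<tau>. \<bar>y - c\<bar> \<le> s"
        then obtain y where y: "y \<in> ?Y q S \<tau>" "\<bar>y - c\<bar> \<le> s" by blast
        obtain x where x: "\<forall>i\<in>{1..q}. x i \<in> F (\<tau> i)" "y = (\<Sum>i\<in>{1..q}. x i * \<mu> (S i))"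
          using y(1) unfolding mem_sum_set_times_elt_iff by blast
        obtain f where f: "f \<in> simple_selections F" "\<bar>y - simple_int \<mu> f A\<bar> \<le> r2"
          using \<gamma>2(2)[OF part fine(2) x(1)] unfolding x(2) by blast
        have "\<bar>simple_int \<mu> f A - z\<bar> \<le> \<bar>simple_int \<mu> f A - y\<bar> + \<bar>y - z\<bar>"
          using abs_triangle_ineq[of "simple_int \<mu> f A - y" "y - z"] by simp
        also have "\<dots> \<le> \<bar>simple_int \<mu> f A - y\<bar> + (\<bar>y - c\<bar> + \<bar>c - z\<bar>)"
          using abs_triangle_ineq[of "y - c" "c - z"] by (intro add_left_mono) simp
        also have "\<dots> \<le> r2 + (s + r1)"
          using f(2) y(2) c(2) by (intro add_mono) (simp_all add: abs_minus_commute)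
        finally show "\<exists>x\<in>?X. \<bar>x - z\<bar> \<le> r1 + r2 + s"
          using f(1) by (auto simp: ac_simps)
      qed
    qed
  qed
qed

text \<open>
  An integrable \<open>f\<close> selects from \<open>F\<close> off a null set \<open>N\<close> only, and changing it on \<open>N\<close> to a selection \<open>f'\<close>
  may destroy integrability.  Yet along the partitions of \<open>fine_partition_few_null_tags\<close> the Riemann
  sums of \<open>f\<close> and \<open>f'\<close> are close, which is enough to locate the integral of \<open>f\<close>.
\<close>

lemma aumann_integral_subset_cl_simple_int:
  assumes F: "simple_function borel F" and ne: "\<And>t. F t \<noteq> {}"
    and H: "\<And>t x. x \<in> F t \<Longrightarrow> \<bar>x\<bar> \<le> H" and A: "compact A"
  shows "aumann_integral \<mu> F A \<subseteq> cl ((\<lambda>f. simple_int \<mu> f A) ` simple_selections F)"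
proof
  let ?X = "(\<lambda>f. simple_int \<mu> f A) ` simple_selections F"
  fix z assume "z \<in> aumann_integral \<mu> F A"
  then obtain f where KH: "has_KH_integral \<mu> f A z" and "ae \<mu> (\<lambda>t. f t \<in> F t)"
    unfolding aumann_integral_def S1_def by blast
  then obtain N where N: "N \<in> sets borel" "\<mu> N = 0" "\<And>t. t \<notin> N \<Longrightarrow> f t \<in> F t"
    unfolding ae_def by blast
  define f' where "f' = (\<lambda>t. if t \<in> N then SOME x. x \<in> F t else f t)"
  have f': "f' t \<in> F t" for t
    unfolding f'_def using N(3) ne by (simp add: some_in_eq)
  show "z \<in> cl ?X"
  proof (rule in_cl_diagonal)
    show "\<bar>x\<bar> \<le> H * \<mu> A" if "x \<in> ?X" for x
      by (rule abs_simple_selection_int_le[OF that H borel_compact[OF A]])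
    show "order_approx (\<lambda>r. order_approx (\<lambda>s. \<exists>x\<in>?X. \<bar>x - z\<bar> \<le> r + s))"
      using KH[unfolded has_KH_integral_iff] simple_selections_riemann_sum[where F = F and H = H and A = A, OF F ne H]
    proof (rule order_approx_add)
      fix r1 r2
      assume "\<exists>\<gamma>. gage \<gamma> \<and>
        (\<forall>q S \<tau>. partition_of \<mu> A q S \<tau> \<and> gamma_fine \<gamma> q S \<tau> \<longrightarrow>
          \<bar>(\<Sum>i\<in>{1..q}. f (\<tau> i) * \<mu> (S i)) - z\<bar> \<le> r1)"
      then obtain \<gamma>1 where \<gamma>1: "gage \<gamma>1" "\<And>q S \<tau>. partition_of \<mu> A q S \<tau> \<Longrightarrow> gamma_fine \<gamma>1 q S \<tau> \<Longrightarrow>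
          \<bar>(\<Sum>i\<in>{1..q}. f (\<tau> i) * \<mu> (S i)) - z\<bar> \<le> r1"
        by blast
      assume "\<exists>\<gamma>. gage \<gamma> \<and>
        (\<forall>q S \<tau> x. partition_of \<mu> A q S \<tau> \<and> gamma_fine \<gamma> q S \<tau> \<and> (\<forall>i\<in>{1..q}. x i \<in> F (\<tau> i)) \<longrightarrow>
          (\<exists>f\<in>simple_selections F. \<bar>(\<Sum>i\<in>{1..q}. x i * \<mu> (S i)) - simple_int \<mu> f A\<bar> \<le> r2))"
      then obtain \<gamma>2 where \<gamma>2: "gage \<gamma>2" "\<And>q S \<tau> x. partition_of \<mu> A q S \<tau> \<Longrightarrow> gamma_fine \<gamma>2 q S \<tau> \<Longrightarrow>
          \<forall>i\<in>{1..q}. x i \<in> F (\<tau> i) \<Longrightarrow>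
          \<exists>f\<in>simple_selections F. \<bar>(\<Sum>i\<in>{1..q}. x i * \<mu> (S i)) - simple_int \<mu> f A\<bar> \<le> r2"
        by blast
      show "order_approx (\<lambda>s. \<exists>x\<in>?X. \<bar>x - z\<bar> \<le> r1 + r2 + s)"
        using fine_partition_few_null_tags[OF A gage_min[OF \<gamma>1(1) \<gamma>2(1)] N(1,2),
            of "\<lambda>t. \<bar>f t - f' t\<bar>", OF abs_ge_zero]
      proof (rule order_approx_mono)
        fix s assume "\<exists>q S \<tau>. partition_of \<mu> A q S \<tau> \<and> gamma_fine (\<lambda>t. min (\<gamma>1 t) (\<gamma>2 t)) q S \<tau> \<and>
          (\<Sum>i\<in>{1..q}. if \<tau> i \<in> N then \<bar>f (\<tau> i) - f' (\<tau> i)\<bar> * \<mu> (S i) else 0) \<le> s"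
        then obtain q S \<tau> where part: "partition_of \<mu> A q S \<tau>"
            and fine: "gamma_fine \<gamma>1 q S \<tau>" "gamma_fine \<gamma>2 q S \<tau>"
            and s: "(\<Sum>i\<in>{1..q}. if \<tau> i \<in> N then \<bar>f (\<tau> i) - f' (\<tau> i)\<bar> * \<mu> (S i) else 0) \<le> s"
          unfolding gamma_fine_min by blast
        let ?y = "\<Sum>i\<in>{1..q}. f (\<tau> i) * \<mu> (S i)" and ?y' = "\<Sum>i\<in>{1..q}. f' (\<tau> i) * \<mu> (S i)"
        obtain g where g: "g \<in> simple_selections F" "\<bar>?y' - simple_int \<mu> g A\<bar> \<le> r2"
          using \<gamma>2(2)[OF part fine(2), of "\<lambda>i. f' (\<tau> i)"] f' by blast
        have S: "0 \<le> \<mu> (S i)" if "i \<in> {1..q}" for i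
          using part that unfolding partition_of_def by (blast intro: nonneg)
        have "?y - ?y' = (\<Sum>i\<in>{1..q}. (f (\<tau> i) - f' (\<tau> i)) * \<mu> (S i))"
          unfolding prod_diff_left by (rule sum_subtractf[symmetric])
        also have "\<bar>\<dots>\<bar> \<le> (\<Sum>i\<in>{1..q}. \<bar>(f (\<tau> i) - f' (\<tau> i)) * \<mu> (S i)\<bar>)"
          by (rule sum_abs)
        also have "\<dots> \<le> (\<Sum>i\<in>{1..q}. if \<tau> i \<in> N then \<bar>f (\<tau> i) - f' (\<tau> i)\<bar> * \<mu> (S i) else 0)"
          by (rule sum_mono) (use S in \<open>auto intro: abs_prod_le simp: f'_def\<close>)
        finally have diff: "\<bar>?y' - ?y\<bar> \<le> s" using s by (simp add: abs_minus_commute)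
        have "\<bar>simple_int \<mu> g A - z\<bar> \<le> \<bar>simple_int \<mu> g A - ?y'\<bar> + \<bar>?y' - z\<bar>"
          using abs_triangle_ineq[of "simple_int \<mu> g A - ?y'" "?y' - z"] by simp
        also have "\<dots> \<le> \<bar>simple_int \<mu> g A - ?y'\<bar> + (\<bar>?y' - ?y\<bar> + \<bar>?y - z\<bar>)"
          using abs_triangle_ineq[of "?y' - ?y" "?y - z"] by (intro add_left_mono) simp
        also have "\<dots> \<le> r2 + (s + r1)"
          using g(2) diff \<gamma>1(2)[OF part fine(1)] by (intro add_mono) (simp_all add: abs_minus_commute)
        finally show "\<exists>x\<in>?X. \<bar>x - z\<bar> \<le> r1 + r2 + s"
          using g(1) by (auto simp: ac_simps)
      qed
    qed
  qed
qed

text \<open>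
  A simple selection is integrable, and its own Riemann sums belong to the sums of \<open>F\<close>.  The diagonal
  argument is carried out with the algebraic sum instead of its closure, because the bound
  \<open>H * \<mu> A\<close> for its elements is immediate.
\<close>

lemma cl_simple_int_subset_star_integral:
  assumes H: "\<And>t x. x \<in> F t \<Longrightarrow> \<bar>x\<bar> \<le> H"
  shows "cl ((\<lambda>f. simple_int \<mu> f A) ` simple_selections F) \<subseteq> star_integral \<mu> F A"
proof
  let ?X = "(\<lambda>f. simple_int \<mu> f A) ` simple_selections F"
  let ?Y = "\<lambda>q S \<tau>. \<Sum>i\<in>{1..q}. set_times_elt (F (\<tau> i)) (\<mu> (S i))"
  fix z assume z: "z \<in> cl ?X"
  let ?P = "\<lambda>r. \<exists>\<gamma>. gage \<gamma> \<and> (\<forall>q S \<tau>. partition_of \<mu> A q S \<tau> \<and> gamma_fine \<gamma> q S \<tau> \<longrightarrow>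
    (\<exists>c\<in>?Y q S \<tau>. \<bar>c - z\<bar> \<le> r))"
  have "order_approx ?P"
  proof (rule order_approx_diagonal[where u = "\<bar>H * \<mu> A\<bar> + \<bar>z\<bar>"])
    show "order_approx (\<lambda>r. order_approx (\<lambda>s. ?P (r + s)))"
      using z[unfolded in_cl_iff]
    proof (rule order_approx_mono)
      fix r assume "\<exists>x\<in>?X. \<bar>x - z\<bar> \<le> r"
      then obtain f where f: "f \<in> simple_selections F" "\<bar>simple_int \<mu> f A - z\<bar> \<le> r" by blast
      then have "has_KH_integral \<mu> f A (simple_int \<mu> f A)"
        by (intro has_KH_integral_simple) (simp add: simple_selections_def)
      then show "order_approx (\<lambda>s. ?P (r + s))"
        unfolding has_KH_integral_iff
      proof (rule order_approx_mono)
        fix s assume "\<exists>\<gamma>. gage \<gamma> \<and> (\<forall>q S \<tau>. partition_of \<mu> A q S \<tau> \<and> gamma_fine \<gamma> q S \<tau> \<longrightarrow>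
          \<bar>(\<Sum>i\<in>{1..q}. f (\<tau> i) * \<mu> (S i)) - simple_int \<mu> f A\<bar> \<le> s)"
        then obtain \<gamma> where \<gamma>: "gage \<gamma>" "\<And>q S \<tau>. partition_of \<mu> A q S \<tau> \<Longrightarrow> gamma_fine \<gamma> q S \<tau> \<Longrightarrow>
          \<bar>(\<Sum>i\<in>{1..q}. f (\<tau> i) * \<mu> (S i)) - simple_int \<mu> f A\<bar> \<le> s" by blast
        have "\<exists>c\<in>?Y q S \<tau>. \<bar>c - z\<bar> \<le> r + s"
          if "partition_of \<mu> A q S \<tau>" "gamma_fine \<gamma> q S \<tau>" for q S \<tau>
        proof
          let ?c = "\<Sum>i\<in>{1..q}. f (\<tau> i) * \<mu> (S i)"
          show "?c \<in> ?Y q S \<tau>"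
            unfolding mem_sum_set_times_elt_iff using f(1) by (auto simp: simple_selections_def)
          have "\<bar>?c - z\<bar> \<le> \<bar>?c - simple_int \<mu> f A\<bar> + \<bar>simple_int \<mu> f A - z\<bar>"
            using abs_triangle_ineq[of "?c - simple_int \<mu> f A" "simple_int \<mu> f A - z"] by simp
          also have "\<dots> \<le> s + r" using \<gamma>(2)[OF that] f(2) by (rule add_mono)
          finally show "\<bar>?c - z\<bar> \<le> r + s" by (simp add: add.commute)
        qed
        then show "?P (r + s)" using \<gamma>(1) by blast
      qed
    qed
    show "?P s" if "?P r" "r \<le> s" for r s
      using that(1) order_trans[OF _ that(2)] by blast
    show "?P (inf r (\<bar>H * \<mu> A\<bar> + \<bar>z\<bar>))" if P: "?P r" for r
    proof -
      obtain \<gamma> where \<gamma>: "gage \<gamma>" "\<And>q S \<tau>. partition_of \<mu> A q S \<tau> \<Longrightarrow> gamma_fine \<gamma> q S \<tau> \<Longrightarrow>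
          \<exists>c\<in>?Y q S \<tau>. \<bar>c - z\<bar> \<le> r"
        using P by blast
      have "\<exists>c\<in>?Y q S \<tau>. \<bar>c - z\<bar> \<le> inf r (\<bar>H * \<mu> A\<bar> + \<bar>z\<bar>)"
        if part: "partition_of \<mu> A q S \<tau>" and fine: "gamma_fine \<gamma> q S \<tau>" for q S \<tau>
      proof -
        obtain c where c: "c \<in> ?Y q S \<tau>" "\<bar>c - z\<bar> \<le> r" using \<gamma>(2)[OF part fine] by blast
        obtain x where x: "\<And>i. i \<in> {1..q} \<Longrightarrow> x i \<in> F (\<tau> i)" "c = (\<Sum>i\<in>{1..q}. x i * \<mu> (S i))"
          using c(1) unfolding mem_sum_set_times_elt_iff by blast
        have "\<bar>c\<bar> \<le> H * \<mu> A"
          unfolding x(2) by (rule abs_riemann_sum_le[OF part H[OF x(1)]])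
        then show ?thesis using c(1) abs_diff_le_inf[OF _ c(2)] by blast
      qed
      then show ?thesis using \<gamma>(1) by blast
    qed
  qed simp
  then show "z \<in> star_integral \<mu> F A"
    unfolding in_star_integral_iff
  proof (rule order_approx_mono)
    fix r assume "?P r"
    then obtain \<gamma> where \<gamma>: "gage \<gamma>" "\<And>q S \<tau>. partition_of \<mu> A q S \<tau> \<Longrightarrow> gamma_fine \<gamma> q S \<tau> \<Longrightarrow>
        \<exists>c\<in>?Y q S \<tau>. \<bar>c - z\<bar> \<le> r" by blast
    have "\<exists>c\<in>cl_sum q (\<lambda>i. set_times_elt (F (\<tau> i)) (\<mu> (S i))). \<bar>z - c\<bar> \<le> r"
      if part: "partition_of \<mu> A q S \<tau>" and fine: "gamma_fine \<gamma> q S \<tau>" for q S \<tau>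
    proof -
      obtain c where c: "c \<in> ?Y q S \<tau>" "\<bar>c - z\<bar> \<le> r" using \<gamma>(2)[OF part fine] by blast
      then show ?thesis
        using subset_cl[of "?Y q S \<tau>"] unfolding cl_sum_def
        by (intro bexI[of _ c]) (auto simp: abs_minus_commute)
    qed
    then show "\<exists>\<gamma>. gage \<gamma> \<and> (\<forall>q S \<tau>. partition_of \<mu> A q S \<tau> \<and> gamma_fine \<gamma> q S \<tau> \<longrightarrow>
        (\<exists>c\<in>cl_sum q (\<lambda>i. set_times_elt (F (\<tau> i)) (\<mu> (S i))). \<bar>z - c\<bar> \<le> r))"
      using \<gamma>(1) by blast
  qed
qed

text \<open>
  For closed, hence compact, \<open>A\<close> both sides are the closure of the set of integrals of simple
  selections.
\<close>

theorem star_integral_eq_cl_aumann_integral: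
  assumes F: "simple_function borel F" and ne: "\<And>t. F t \<noteq> {}"
    and H: "\<And>t x. x \<in> F t \<Longrightarrow> \<bar>x\<bar> \<le> H"
  shows "star_integral \<mu> F A = cl (aumann_integral \<mu> F A)"
proof (cases "closed A")
  case False
  have "(\<lambda>t. SOME x. x \<in> F t) \<in> S1 \<mu> F"
    using simple_selections_subset_S1 ex_simple_selection[OF F ne] by blast
  from integrals_eq_UNIV_if_not_closed[OF False this] show ?thesis
    using subset_cl[of "UNIV :: 'r set"] by auto
next
  case True
  then have A: "compact A" using compact_Int_closed[OF compact_space] by simp
  let ?X = "(\<lambda>f. simple_int \<mu> f A) ` simple_selections F"
  have "cl (aumann_integral \<mu> F A) \<subseteq> cl (cl ?X)"
    by (rule cl_mono[OF aumann_integral_subset_cl_simple_int[OF F ne H A]])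
  also have "\<dots> \<subseteq> cl ?X"
    by (rule cl_cl_subset, rule abs_simple_selection_int_le[OF _ H borel_compact[OF A]])
  finally have "cl (aumann_integral \<mu> F A) \<subseteq> cl ?X" .
  moreover have "cl ?X \<subseteq> cl (aumann_integral \<mu> F A)"
    by (rule cl_mono) (use simple_int_in_aumann_integral in blast)
  moreover have "star_integral \<mu> F A = cl ?X"
  proof (rule antisym)
    show "star_integral \<mu> F A \<subseteq> cl ?X"
      by (rule star_integral_subset_cl_simple_int[OF F ne H A])
    show "cl ?X \<subseteq> star_integral \<mu> F A"
      by (rule cl_simple_int_subset_star_integral[OF H])
  qed
  ultimately show ?thesis by simp
qed

end

section \<open>Step multifunctions\<close>

lemma simple_multifunction_cases:
  assumes "disjoint_family_on E {1..n}"
  shows "k \<in> {1..n} \<Longrightarrow> t \<in> E k \<Longrightarrow> simple_multifunction n C E t = C k"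
    and "t \<notin> (\<Union>k\<in>{1..n}. E k) \<Longrightarrow> simple_multifunction n C E t = {0}"
proof -
  assume k: "k \<in> {1..n}" "t \<in> E k"
  have "j = k" if "j \<in> {1..n}" "t \<in> E j" for j
    using disjoint_family_onD[OF assms that(1) k(1)] that(2) k(2) by blast
  then have "{k \<in> {1..n}. t \<in> E k} = {k}" using k by blast
  then show "simple_multifunction n C E t = C k"
    unfolding simple_multifunction_def using k by auto
qed (simp add: simple_multifunction_def)

text \<open>
  \<open>F\<close> as a simple function whose values are sets: its value depends on the number of the set \<open>E k\<close>
  containing \<open>t\<close>, and on whether there is one.
\<close>

lemma simple_function_simple_multifunction:
  fixes E :: "nat \<Rightarrow> 't::metric_space set"
  assumes E: "\<And>k. k \<in> {1..n} \<Longrightarrow> E k \<in> sets borel" "disjoint_family_on E {1..n}"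
  shows "simple_function borel (simple_multifunction n C E)"
proof -
  obtain \<iota> :: "'t \<Rightarrow> nat" where \<iota>: "simple_function borel \<iota>"
      "\<And>k t. k \<in> {1..n} \<Longrightarrow> t \<in> E k \<Longrightarrow> \<iota> t = k"
    using ex_simple_index[of "{1..n}" E] E by blast
  let ?U = "\<Union>k\<in>{1..n}. E k"
  have "simple_function borel (\<lambda>t. if indicator ?U t = (1::nat) then C (\<iota> t) else {0})"
    by (rule simple_function_compose2[OF simple_function_indicator \<iota>(1), where
          h = "\<lambda>b i. if b = 1 then C i else {0}"]) (intro sets.finite_UN E(1) finite_atLeastAtMost)
  moreover have "(if indicator ?U t = (1::nat) then C (\<iota> t) else {0}) = simple_multifunction n C E t"
    for t
  proof (cases "t \<in> ?U")
    case True
    then obtain k where k: "k \<in> {1..n}" "t \<in> E k" by blast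
    then show ?thesis
      using True by (simp add: \<iota>(2)[OF k] simple_multifunction_cases(1)[OF E(2) k])
  next
    case False
    then show ?thesis by (simp add: simple_multifunction_cases(2)[OF E(2)])
  qed
  ultimately show ?thesis by simp
qed

lemma simple_multifunction_bounded:
  fixes C :: "nat \<Rightarrow> 'r::dedekind_complete_riesz_space set"
  assumes C: "\<And>k. k \<in> {1..n} \<Longrightarrow> bdd_above (C k) \<and> bdd_below (C k)"
    and E: "disjoint_family_on E {1..n}"
  obtains H where "\<And>t x. x \<in> simple_multifunction n C E t \<Longrightarrow> \<bar>x\<bar> \<le> H"
proof -
  have "\<exists>b. \<forall>x\<in>C k. \<bar>x\<bar> \<le> b" if k: "k \<in> {1..n}" for k
  proof -
    obtain l u where lu: "\<And>x. x \<in> C k \<Longrightarrow> l \<le> x" "\<And>x. x \<in> C k \<Longrightarrow> x \<le> u"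
      using C[OF k] unfolding bdd_above_def bdd_below_def by blast
    have "\<bar>x\<bar> \<le> sup u (- l)" if "x \<in> C k" for x
      using lu[OF that] by (intro abs_leI) (auto intro: le_supI1 le_supI2)
    then show ?thesis by blast
  qed
  then have "\<forall>k\<in>{1..n}. \<exists>b. \<forall>x\<in>C k. \<bar>x\<bar> \<le> b" by blast
  then obtain b where b: "\<And>k x. k \<in> {1..n} \<Longrightarrow> x \<in> C k \<Longrightarrow> \<bar>x\<bar> \<le> b k"
    by (subst (asm) bchoice_iff) blast
  let ?H = "\<Sum>k\<in>{1..n}. \<bar>b k\<bar>"
  have "\<bar>x\<bar> \<le> ?H" if x: "x \<in> simple_multifunction n C E t" for t x
  proof (cases "t \<in> (\<Union>k\<in>{1..n}. E k)")
    case True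
    then obtain k where k: "k \<in> {1..n}" "t \<in> E k" by blast
    then have "x \<in> C k" using x by (simp only: simple_multifunction_cases(1)[OF E k])
    then have "\<bar>x\<bar> \<le> \<bar>b k\<bar>" using b[OF k(1)] abs_ge_self order_trans by blast
    also have "\<dots> \<le> ?H"
      using sum_mono2[of "{1..n}" "{k}" "\<lambda>k. \<bar>b k\<bar>"] k(1) by simp
    finally show ?thesis .
  next
    case False
    have "x = 0" using x by (simp only: simple_multifunction_cases(2)[OF E False] singleton_iff)
    then show ?thesis by (simp add: sum_nonneg)
  qed
  then show thesis by (rule that)
qed

theorem corollary18:
  fixes \<mu> :: "'t::metric_space set \<Rightarrow>
      'r::{super_dedekind_complete_riesz_space, weakly_sigma_distributive_riesz_space,
           dedekind_complete_algebra}"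
    and F :: "'t \<Rightarrow> 'r set"
    and C :: "nat \<Rightarrow> 'r set"
    and E :: "nat \<Rightarrow> 't set"
    and A :: "'t set"
    and n :: nat
  assumes "compact (UNIV :: 't set)"
    and "\<forall>S\<in>sets borel. 0 \<le> \<mu> S"
    and "additive (sets borel) \<mu>"
    and "regular_mapping \<mu>"
    and "\<forall>k\<in>{1..n}. E k \<in> sets borel"
    and "disjoint_family_on E {1..n}"
    and "\<forall>k\<in>{1..n}. C k \<in> cf"
    and "F = simple_multifunction n C E"
    and "A \<in> sets borel"
  shows "star_integral \<mu> F A = cl (aumann_integral \<mu> F A)"
proof -
  interpret regular_additive \<mu>
    by (rule regular_additive.intro) (use assms(1-4) in blast)+
  have ne: "C k \<noteq> {}" if "k \<in> {1..n}" for k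
    using bspec[OF assms(7) that] unfolding cf_def by blast
  have bdd: "bdd_above (C k) \<and> bdd_below (C k)" if "k \<in> {1..n}" for k
    using bspec[OF assms(7) that] unfolding cf_def mem_Collect_eq by (elim conjE, intro conjI)
  obtain H where H: "\<And>t x. x \<in> F t \<Longrightarrow> \<bar>x\<bar> \<le> H"
    using simple_multifunction_bounded[where C = C, OF bdd assms(6)] unfolding assms(8) by blast
  have "F t \<noteq> {}" for t
  proof (cases "t \<in> (\<Union>k\<in>{1..n}. E k)")
    case True
    then obtain k where k: "k \<in> {1..n}" "t \<in> E k" by blast
    then show ?thesis
      unfolding assms(8) simple_multifunction_cases(1)[OF assms(6) k] using ne by blast
  next
    case False
    show ?thesis
      unfolding assms(8) simple_multifunction_cases(2)[OF assms(6) False] by blast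
  qed
  moreover have "simple_function borel F"
    unfolding assms(8) using assms(5,6) by (intro simple_function_simple_multifunction) auto
  ultimately show ?thesis
    using H by (intro star_integral_eq_cl_aumann_integral)
qed

end
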